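(* Let $M$ be a combinatorial $3$-manifold and $S$ a slicing of $M$ which is a weakly neighborly polyhedral map. Then $S$ is combinatorially isomorphic to one of the following: the boundary of the $3$-simplex; the boundary of the triangular prism $\Delta^1\times\Delta^2$ (6 vertices, 2 triangles, 3 quadrilaterals); or the $3\times 3$-grid torus (the quadrangulated torus with vertex set $\mathbb{Z}_3\times\mathbb{Z}_3$ and the nine quadrilaterals $\{(i,j),(i+1,j),(i+1,j+1),(i,j+1)\}$, $i,j\in\mathbb{Z}_3$).
   Context: A combinatorial $3$-manifold is a finite pure $3$-dimensional simplicial complex in which the link of every vertex is a combinatorial $2$-sphere. A function $f:M\to\mathbb{R}$ is regular simplexwise linear (rsl) if it is linear on every simplex and takes pairwise distinct values on the vertices. A slicing of $M$ is a level set $f^{-1}(x)$ of an rsl-function $f$ at a value $x$ not equal to $f(v)$ for any vertex $v$; it is a polyhedral surface whose facets are triangles and quadrilaterals, obtained by intersecting $f^{-1}(x)$ with the tetrahedra of $M$. A polyhedral map is weakly neighborly if any two of its vertices lie in a common face. *)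

theory Defs
  imports "HOL-Analysis.Analysis"
begin

definition simplicial_complex :: "'v set set \<Rightarrow> bool" where
  "simplicial_complex K \<longleftrightarrow> finite K \<and> (\<forall>\<sigma>\<in>K. finite \<sigma> \<and> \<sigma> \<noteq> {}) \<and>
     (\<forall>\<sigma>\<in>K. \<forall>\<tau>. \<tau> \<subseteq> \<sigma> \<and> \<tau> \<noteq> {} \<longrightarrow> \<tau> \<in> K)"

definition cvertices :: "'v set set \<Rightarrow> 'v set" where
  "cvertices K = \<Union>K"

definition pure_dim :: "'v set set \<Rightarrow> nat \<Rightarrow> bool" where
  "pure_dim K d \<longleftrightarrow> K \<noteq> {} \<and> (\<forall>\<sigma>\<in>K. card \<sigma> \<le> d + 1) \<and>
     (\<forall>\<sigma>\<in>K. \<exists>\<tau>\<in>K. \<sigma> \<subseteq> \<tau> \<and> card \<tau> = d + 1)"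

definition link :: "'v set set \<Rightarrow> 'v \<Rightarrow> 'v set set" where
  "link K v = {\<sigma>\<in>K. v \<notin> \<sigma> \<and> insert v \<sigma> \<in> K}"

definition realization :: "'v set set \<Rightarrow> ('v \<Rightarrow> real) set" where
  "realization K = {p. (\<forall>u. 0 \<le> p u) \<and> {u. p u \<noteq> 0} \<in> K \<and> sum p {u. p u \<noteq> 0} = 1}"

text \<open>Combinatorial 2-sphere: a pure 2-dimensional simplicial complex whose realization is
homeomorphic to the 2-sphere (in dimension 2 every triangulated sphere is a PL sphere).\<close>
definition combinatorial_2_sphere :: "'v set set \<Rightarrow> bool" where
  "combinatorial_2_sphere L \<longleftrightarrow> simplicial_complex L \<and> pure_dim L 2 \<and>
     realization L homeomorphic sphere (0 :: real^3) 1"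

definition combinatorial_3_manifold :: "'v set set \<Rightarrow> bool" where
  "combinatorial_3_manifold M \<longleftrightarrow> simplicial_complex M \<and> pure_dim M 3 \<and>
     (\<forall>v\<in>cvertices M. combinatorial_2_sphere (link M v))"

section \<open>Polyhedral complexes (vertices, edges, faces as vertex sets)\<close>

type_synonym 'a pcomplex = "'a set \<times> 'a set set \<times> 'a set set"

definition comb_iso :: "'a pcomplex \<Rightarrow> 'b pcomplex \<Rightarrow> bool" where
  "comb_iso S T \<longleftrightarrow> (case S of (V, E, F) \<Rightarrow> case T of (V', E', F') \<Rightarrow>
     (\<exists>\<phi>. bij_betw \<phi> V V' \<and> (\<lambda>e. \<phi> ` e) ` E = E' \<and> (\<lambda>A. \<phi> ` A) ` F = F'))"

definition polyhedral_map :: "'a pcomplex \<Rightarrow> bool" where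
  "polyhedral_map S \<longleftrightarrow> (case S of (V, E, F) \<Rightarrow> V \<noteq> {} \<and>
     (\<forall>A\<in>F. \<forall>B\<in>F. A \<noteq> B \<longrightarrow> A \<inter> B = {} \<or> (\<exists>v. A \<inter> B = {v}) \<or> A \<inter> B \<in> E))"

definition weakly_neighborly :: "'a pcomplex \<Rightarrow> bool" where
  "weakly_neighborly S \<longleftrightarrow> (case S of (V, E, F) \<Rightarrow>
     (\<forall>u\<in>V. \<forall>w\<in>V. \<exists>A\<in>F. u \<in> A \<and> w \<in> A))"

text \<open>The rsl-function is given by its (pairwise distinct) values f on the vertices.
Vertices of the slicing at level x are the edges of M crossing level x; each crossed
triangle gives an edge, each crossed tetrahedron gives a face (triangle or quadrilateral),
each recorded by its set of slice vertices.\<close>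
definition crossing :: "('v \<Rightarrow> real) \<Rightarrow> real \<Rightarrow> 'v set \<Rightarrow> bool" where
  "crossing f x \<sigma> \<longleftrightarrow> (\<exists>u\<in>\<sigma>. f u < x) \<and> (\<exists>w\<in>\<sigma>. x < f w)"

definition slice_vertices :: "'v set set \<Rightarrow> ('v \<Rightarrow> real) \<Rightarrow> real \<Rightarrow> 'v set set" where
  "slice_vertices M f x = {e\<in>M. card e = 2 \<and> crossing f x e}"

definition slicing :: "'v set set \<Rightarrow> ('v \<Rightarrow> real) \<Rightarrow> real \<Rightarrow> 'v set pcomplex" where
  "slicing M f x = (slice_vertices M f x,
     {{e\<in>slice_vertices M f x. e \<subseteq> t} | t. t \<in> M \<and> card t = 3 \<and> crossing f x t},
     {{e\<in>slice_vertices M f x. e \<subseteq> t} | t. t \<in> M \<and> card t = 4 \<and> crossing f x t})"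

definition tetra_boundary :: "nat pcomplex" where
  "tetra_boundary = ({0..<4}, {A. A \<subseteq> {0..<4} \<and> card A = 2}, {A. A \<subseteq> {0..<4} \<and> card A = 3})"

definition prism_boundary :: "nat pcomplex" where
  "prism_boundary = ({0..<6},
     {{0,1},{1,2},{0,2},{3,4},{4,5},{3,5},{0,3},{1,4},{2,5}},
     {{0,1,2},{3,4,5},{0,1,4,3},{1,2,5,4},{2,0,3,5}})"

definition torus_3x3 :: "(nat \<times> nat) pcomplex" where
  "torus_3x3 = ({0..<3} \<times> {0..<3},
     {{(i,j),((i+1) mod 3, j)} | i j. i < 3 \<and> j < 3} \<union>
     {{(i,j),(i, (j+1) mod 3)} | i j. i < 3 \<and> j < 3},
     {{(i,j),((i+1) mod 3, j),((i+1) mod 3,(j+1) mod 3),(i,(j+1) mod 3)} | i j. i < 3 \<and> j < 3})"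

end

theory Submission
  imports Defs
begin

text \<open>Let \<open>A\<close> and \<open>B\<close> be the sets of lower and upper endpoints of the edges of \<open>M\<close> that cross the level.
Two slice vertices in a common face are two crossing edges in a common tetrahedron, so weak
neighborliness says that \<open>{a, a', b, b'}\<close> is a simplex for all \<open>a, a'\<close> in \<open>A\<close> and \<open>b, b'\<close> in \<open>B\<close>.

Every triangle of \<open>M\<close> lies in exactly two tetrahedra (invariance of domain in a vertex link). The
triangle \<open>a a' b\<close> already lies in \<open>|B| - 1\<close> tetrahedra meeting \<open>B\<close> twice, whence \<open>|B| \<le> 3\<close>, and
likewise \<open>|A| \<le> 3\<close>, as soon as both sets have two elements. The remaining tetrahedra are then
determined: sizes (2,2) are impossible, (2,3) gives the prism and (3,3) the torus.

If \<open>A = {a}\<close>, the slice is the link of \<open>a\<close>, a triangulated 2-sphere with complete 1-skeleton. There any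
three vertices span a triangle: otherwise the complement of their 3-cycle would be connected,
since the other vertices are pairwise adjacent, contradicting the Jordan curve theorem. As every edge
lies in two triangles, there are exactly four vertices.\<close>

subsection \<open>Triangulated 2-spheres\<close>

lemma simplicial_complex_subset:
  "simplicial_complex K \<Longrightarrow> \<sigma> \<in> K \<Longrightarrow> \<tau> \<subseteq> \<sigma> \<Longrightarrow> \<tau> \<noteq> {} \<Longrightarrow> \<tau> \<in> K"
  unfolding simplicial_complex_def by blast

lemma realizationI:
  assumes "\<sigma> \<in> K" "{u. p u \<noteq> 0} = \<sigma>" "\<And>u. 0 \<le> p u" "sum p \<sigma> = 1"
  shows "p \<in> realization K"
  using assms by (simp add: realization_def)

lemma continuous_on_coordinate: "continuous_on S (\<lambda>p::'v \<Rightarrow> real. p u)"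
  by (rule continuous_on_product_then_coordinatewise[OF continuous_on_id])

section \<open>Transfer of plane topology to the 2-sphere\<close>

lemma punctured_2_sphere_homeomorphic_plane:
  assumes "b \<in> sphere (0::real^3) 1"
  shows "(sphere 0 1 - {b}) homeomorphic (UNIV :: complex set)"
  using assms by (intro homeomorphic_punctured_sphere_affine) auto

text \<open>Puncturing the sphere at the missed point \<open>b\<close> turns the target into a
  plane, where invariance of domain applies; the punctured sphere is open in the sphere, so openness
  carries over.\<close>

lemma invariance_of_domain_plane_into_2_sphere:
  fixes F :: "complex \<Rightarrow> real^3"
  assumes "open U" "continuous_on U F" "inj_on F U" "F ` U \<subseteq> sphere 0 1"
    and b: "b \<in> sphere 0 1" "b \<notin> F ` U"
  shows "openin (top_of_set (sphere 0 1)) (F ` U)"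
proof -
  let ?S = "sphere (0::real^3) 1"
  obtain \<theta> \<eta> where hom: "homeomorphism (?S - {b}) (UNIV::complex set) \<theta> \<eta>"
    using punctured_2_sphere_homeomorphic_plane[OF b(1)] by (auto simp: homeomorphic_def)
  have sub: "F ` U \<subseteq> ?S - {b}"
    using assms by auto
  have "open ((\<theta> \<circ> F) ` U)"
  proof (rule invariance_of_domain)
    show "continuous_on U (\<theta> \<circ> F)"
      using assms hom sub
      by (intro continuous_on_compose) (auto simp: homeomorphism_def intro: continuous_on_subset)
    have "inj_on \<theta> (F ` U)"
      using hom sub by (intro inj_on_inverseI[of _ \<eta>]) (auto simp: homeomorphism_def)
    then show "inj_on (\<theta> \<circ> F) U"
      using assms by (intro comp_inj_on)
  qed (use assms in auto)
  then have "openin (top_of_set (?S - {b})) (\<eta> ` (\<theta> \<circ> F) ` U)"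
    using homeomorphism_imp_open_map[OF homeomorphism_symD[OF hom]] by simp
  then have "openin (top_of_set ?S) (\<eta> ` (\<theta> \<circ> F) ` U)"
    by (rule openin_trans[OF _ openin_delete[OF openin_subtopology_self]])
  moreover have "\<eta> ` (\<theta> \<circ> F) ` U = F ` U"
    using hom sub by (force simp: homeomorphism_def image_iff image_subset_iff)
  ultimately show ?thesis
    by simp
qed

text \<open>Jordan-Brouwer separation in the plane, seen through the chart of the sphere punctured
  at \<open>b\<close>. A bounded complementary component pulls back to a nonempty clopen subset of
  the complement that misses \<open>b\<close>.\<close>

lemma simple_closed_curve_separates_2_sphere:
  assumes C: "C homeomorphic sphere (0::complex) 1"
    and sub: "C \<subseteq> sphere (0::real^3) 1" and b: "b \<in> sphere 0 1 - C"
  shows "\<not> connected (sphere 0 1 - C)"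
proof
  let ?S = "sphere (0::real^3) 1"
  assume con: "connected (?S - C)"
  obtain \<theta> \<eta> where hom: "homeomorphism (?S - {b}) (UNIV::complex set) \<theta> \<eta>"
    using b punctured_2_sphere_homeomorphic_plane[of b] by (auto simp: homeomorphic_def)
  have CS: "C \<subseteq> ?S - {b}"
    using sub b by auto
  have \<eta>\<theta>: "\<eta> (\<theta> p) = p" if "p \<in> ?S - {b}" for p
    using hom that by (auto simp: homeomorphism_def)
  have \<theta>\<eta>: "\<theta> (\<eta> c) = c" for c
    using hom by (auto simp: homeomorphism_def)
  have \<eta>S: "\<eta> c \<in> ?S - {b}" for c
    using hom unfolding homeomorphism_def by blast
  have cont\<eta>: "continuous_on X \<eta>" for X
    using hom by (auto simp: homeomorphism_def intro: continuous_on_subset)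
  have "C homeomorphic \<theta> ` C"
    using hom CS by (meson homeomorphic_def homeomorphism_of_subsets subset_UNIV)
  then have hC': "\<theta> ` C homeomorphic sphere (0::complex) 1"
    using C by (meson homeomorphic_sym homeomorphic_trans)
  then have comp: "compact (\<theta> ` C)"
    using homeomorphic_compactness compact_sphere by blast
  have "\<not> connected (- \<theta> ` C)"
    using hC' by (rule Jordan_Brouwer_separation) simp
  moreover have "bounded (- (- \<theta> ` C))"
    using comp by (simp add: compact_imp_bounded)
  \<comment> \<open>Boundedness is the point of this choice: it makes the union of the plane curve
    with \<open>W\<close> compact, so that its image under \<open>\<eta>\<close> is closed in the
    whole sphere.\<close>
  ultimately obtain W where W: "W \<in> components (- \<theta> ` C)" "bounded W"
    using cobounded_has_bounded_component[of "- \<theta> ` C"] by auto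
  have "open W"
    using W comp open_components[of "- \<theta> ` C"] by (simp add: compact_imp_closed open_Compl)
  then have "openin (top_of_set (?S - {b})) (\<eta> ` W)"
    using homeomorphism_imp_open_map[OF homeomorphism_symD[OF hom], of W] by simp
  then have "openin (top_of_set ?S) (\<eta> ` W)"
    by (rule openin_trans[OF _ openin_delete[OF openin_subtopology_self]])
  moreover have WC: "\<eta> ` W \<subseteq> ?S - C"
  proof (rule image_subsetI)
    fix c assume "c \<in> W"
    then have "c \<notin> \<theta> ` C"
      using in_components_subset[OF W(1)] by blast
    then have "\<eta> c \<notin> C"
      using \<theta>\<eta>[of c] by (metis imageI)
    then show "\<eta> c \<in> ?S - C"
      using \<eta>S[of c] by blast
  qed
  ultimately have op: "openin (top_of_set (?S - C)) (\<eta> ` W)"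
    using openin_subset_trans Diff_subset by blast
  have "closed (\<theta> ` C \<union> W)"
    using comp W by (intro closed_Un_complement_component) (auto intro: compact_imp_closed)
  then have "compact (\<theta> ` C \<union> W)"
    using comp W by (simp add: compact_eq_bounded_closed)
  then have "closed (\<eta> ` (\<theta> ` C \<union> W))"
    using cont\<eta> compact_continuous_image compact_imp_closed by blast
  moreover have "\<eta> ` W = (?S - C) \<inter> \<eta> ` (\<theta> ` C \<union> W)"
    using WC \<eta>\<theta> CS by force
  ultimately have cl: "closedin (top_of_set (?S - C)) (\<eta> ` W)"
    by (metis closedin_closed)
  have "\<eta> ` W \<noteq> {}"
    using W in_components_nonempty by auto
  moreover have "\<eta> ` W \<noteq> ?S - C"
  proof
    assume "\<eta> ` W = ?S - C"
    then obtain c where "b = \<eta> c"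
      using b by blast
    then show False
      using \<eta>S[of c] by blast
  qed
  ultimately show False
    using con op cl by (auto simp: connected_clopen)
qed

section \<open>Triangles at an edge of a triangulated 2-sphere\<close>

text \<open>The two triangles over \<open>z\<close> and \<open>w\<close> glue along the edge to an
  open disc, which invariance of domain makes open in the realization. A segment from the middle of
  the edge into the third triangle leaves this disc at once.\<close>

lemma sphere_edge_not_in_three_triangles:
  fixes L :: "'v set set"
  assumes h: "homeomorphism (realization L) (sphere (0::real^3) 1) h k"
    and L: "simplicial_complex L"
    and tri: "{x,y,z} \<in> L" "{x,y,w} \<in> L" "{x,y,u} \<in> L"
    and dist: "distinct [x,y,z,w,u]"
  shows False
proof -
  let ?R = "realization L" and ?S = "sphere (0::real^3) 1"
  \<comment> \<open>Barycentric coordinates on the two triangles: \<open>Re c\<close> is the weight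
    of \<open>x\<close>, the sign of \<open>Im c\<close> selects \<open>z\<close> or
    \<open>w\<close>, and the rest goes to \<open>y\<close>. On \<open>U\<close> the weights of
    \<open>x\<close> and \<open>y\<close> are positive, so the four outer edges are left
    out.\<close>
  define F where "F = (\<lambda>c v. if v = x then Re c else if v = y then 1 - Re c - \<bar>Im c\<bar>
     else if v = z then max (Im c) 0 else if v = w then max (- Im c) 0 else 0)"
  define U where "U = {c. 0 < Re c \<and> Re c + \<bar>Im c\<bar> < 1}"
  have xy: "{x,y} \<in> L" and uL: "{u} \<in> L"
    by (rule simplicial_complex_subset[OF L tri(3)]; blast)+
  have FR: "F c \<in> ?R" if "c \<in> U" for c
  proof -
    consider "Im c = 0" | "Im c > 0" | "Im c < 0" by linarith
    then show ?thesis
    proof cases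
      case 1
      show ?thesis
        by (rule realizationI[OF xy]) (use 1 that dist in \<open>auto simp: F_def U_def\<close>)
    next
      case 2
      show ?thesis
        by (rule realizationI[OF tri(1)]) (use 2 that dist in \<open>auto simp: F_def U_def\<close>)
    next
      case 3
      show ?thesis
        by (rule realizationI[OF tri(2)]) (use 3 that dist in \<open>auto simp: F_def U_def\<close>)
    qed
  qed
  have contF: "continuous_on X F" for X
  proof (rule continuous_on_coordinatewise_then_product)
    show "continuous_on X (\<lambda>c. F c v)" for v
      by (cases "v = x"; cases "v = y"; cases "v = z"; cases "v = w")
        (simp_all add: F_def continuous_intros)
  qed
  have injF: "inj_on F U"
  proof (rule inj_onI)
    fix c d assume "F c = F d"
    then have "F c x = F d x" "F c z = F d z" "F c w = F d w" by simp_all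
    then show "c = d"
      using dist by (auto simp: F_def complex_eq_iff max_def split: if_splits)
  qed
  have openU: "open U"
    unfolding U_def by (intro open_Collect_conj open_Collect_less continuous_intros)
  \<comment> \<open>The vertex \<open>u\<close> has weight 1 here and weight 0 throughout the disc,
    so this is the missed point that invariance of domain into the sphere requires.\<close>
  define d where "d = (\<lambda>v. if v = u then 1 else 0 :: real)"
  have dR: "d \<in> ?R"
    by (rule realizationI[OF uL]) (auto simp: d_def)
  have hk: "k (h p) = p" if "p \<in> ?R" for p
    using h that by (auto simp: homeomorphism_def)
  have injh: "inj_on h ?R"
    using hk by (rule inj_on_inverseI)
  have hS: "h p \<in> ?S" if "p \<in> ?R" for p
    using h that unfolding homeomorphism_def by blast
  have Fu: "F c u = 0" for c
    using dist by (auto simp: F_def)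
  have "openin (top_of_set ?S) ((h \<circ> F) ` U)"
  proof (rule invariance_of_domain_plane_into_2_sphere[OF openU, where b = "h d"])
    show "continuous_on U (h \<circ> F)"
      using contF h FR
      by (intro continuous_on_compose) (auto simp: homeomorphism_def intro: continuous_on_subset)
    show "inj_on (h \<circ> F) U"
      using injF FR by (intro comp_inj_on inj_on_subset[OF injh]) auto
    show "(h \<circ> F) ` U \<subseteq> ?S" "h d \<in> ?S"
      using hS FR dR by auto
    show "h d \<notin> (h \<circ> F) ` U"
    proof
      assume "h d \<in> (h \<circ> F) ` U"
      then obtain c where "c \<in> U" "d = F c"
        using injh dR FR by (auto dest: inj_onD)
      then show False
        using Fu[of c] by (metis d_def zero_neq_one)
    qed
  qed
  then have "openin (top_of_set ?R) (k ` (h \<circ> F) ` U)"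
    using homeomorphism_imp_open_map[OF homeomorphism_symD[OF h]] by simp
  moreover have "k ` (h \<circ> F) ` U = F ` U"
    using hk FR by (force simp: image_iff)
  ultimately obtain O' where O': "open O'" "F ` U = ?R \<inter> O'"
    by (auto simp: openin_open)
  \<comment> \<open>Straight segment from the midpoint of the edge, at \<open>t = 0\<close>, to the
    vertex \<open>u\<close>, at \<open>t = 1\<close>.\<close>
  define \<gamma> where "\<gamma> = (\<lambda>t v. if v = x \<or> v = y then (1 - t) / 2 else if v = u then t else 0 :: real)"
  have "continuous_on UNIV \<gamma>"
  proof (rule continuous_on_coordinatewise_then_product)
    show "continuous_on UNIV (\<lambda>t. \<gamma> t v)" for v
      by (cases "v = x \<or> v = y"; cases "v = u") (auto simp: \<gamma>_def intro!: continuous_intros)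
  qed
  then have "open (\<gamma> -` O')"
    using O' by (simp add: open_vimage)
  moreover have "\<gamma> 0 = F (Complex (1/2) 0)"
    using dist by (auto simp: \<gamma>_def F_def fun_eq_iff)
  then have "0 \<in> \<gamma> -` O'"
    using O'(2) by (force simp: U_def)
  ultimately obtain e where e: "e > 0" "ball 0 e \<subseteq> \<gamma> -` O'"
    by (meson open_contains_ball)
  define t where "t = min (e/2) (1/2)"
  have t: "0 < t" "t < 1" "t \<in> ball 0 e"
    using e by (auto simp: t_def)
  have "\<gamma> t \<in> ?R"
    by (rule realizationI[OF tri(3)]) (use t dist in \<open>auto simp: \<gamma>_def\<close>)
  then have "\<gamma> t \<in> F ` U"
    using subsetD[OF e(2) t(3)] O'(2) by auto
  then have "\<gamma> t u = 0"
    using Fu by auto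
  then show False
    using t dist by (auto simp: \<gamma>_def)
qed

text \<open>With at most one triangle at the edge, the open star of the edge embeds in a closed half
  plane with the edge on the boundary line, whereas invariance of domain makes its image open in the
  plane.\<close>

lemma sphere_edge_not_in_single_triangle:
  fixes L :: "'v set set"
  assumes h: "homeomorphism (realization L) (sphere (0::real^3) 1) h k"
    and L: "simplicial_complex L"
    and xy: "{x,y} \<in> L" "x \<noteq> y" and z: "z \<noteq> x" "z \<noteq> y"
    and only: "\<And>v. v \<notin> {x,y} \<Longrightarrow> {x,y,v} \<in> L \<Longrightarrow> v = z"
  shows False
proof -
  let ?R = "realization L" and ?S = "sphere (0::real^3) 1"
  \<comment> \<open>The open star of the edge. The weight of \<open>y\<close> is
    \<open>1 - p x - p z\<close> there, so the two coordinates kept by \<open>G\<close> determine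
    the point.\<close>
  define H where "H = ?R \<inter> {p. 0 < p x \<and> 0 < p y}"
  define G where "G = (\<lambda>p::'v \<Rightarrow> real. Complex (p x) (p z))"
  have supp: "{u. p u \<noteq> 0} = {x,y} \<or> {u. p u \<noteq> 0} = {x,y,z}" if "p \<in> H" for p
  proof -
    let ?s = "{u. p u \<noteq> 0}"
    have s: "?s \<in> L" "{x,y} \<subseteq> ?s"
      using that by (auto simp: H_def realization_def)
    have "v = z" if "v \<in> ?s - {x,y}" for v
    proof (rule only)
      show "{x,y,v} \<in> L"
        using that s(2) by (intro simplicial_complex_subset[OF L s(1)]) auto
    qed (use that in auto)
    then show ?thesis
      using s(2) by blast
  qed
  have y: "p y = 1 - p x - p z" and p0: "v \<notin> {x,y,z} \<Longrightarrow> p v = 0" if "p \<in> H" for p v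
  proof -
    have sum: "sum p {u. p u \<noteq> 0} = 1"
      using that by (auto simp: H_def realization_def)
    show "p y = 1 - p x - p z"
      using supp[OF that]
    proof
      assume s: "{u. p u \<noteq> 0} = {x,y}"
      then have "p z = 0"
        using z by blast
      then show ?thesis
        using sum xy unfolding s by simp
    next
      assume "{u. p u \<noteq> 0} = {x,y,z}"
      then show ?thesis
        using sum xy z by simp
    qed
    show "v \<notin> {x,y,z} \<Longrightarrow> p v = 0"
      using supp[OF that] by auto
  qed
  have injG: "inj_on G H"
  proof (rule inj_onI)
    fix p q assume pq: "p \<in> H" "q \<in> H" "G p = G q"
    have "p v = q v" for v
      using pq y[of p] y[of q] p0[of p v] p0[of q v]
      by (cases "v \<in> {x,y,z}") (auto simp: G_def)
    then show "p = q" by auto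
  qed
  have contG: "continuous_on X G" for X
    unfolding G_def Complex_eq by (intro continuous_intros continuous_on_coordinate)
  have "open {p::'v \<Rightarrow> real. 0 < p x \<and> 0 < p y}"
    by (intro open_Collect_conj open_Collect_less continuous_on_coordinate continuous_intros)
  then have opH: "openin (top_of_set ?R) H"
    by (auto simp: H_def openin_open)
  then have opS: "openin (top_of_set ?S) (h ` H)"
    by (rule homeomorphism_imp_open_map[OF h])
  have kh: "k (h p) = p" if "p \<in> H" for p
    using h that by (auto simp: homeomorphism_def H_def)
  have "h ` H \<subseteq> ?S"
    using opS openin_imp_subset by blast
  moreover have khH: "k ` h ` H = H"
    using kh by (force simp: image_iff)
  ultimately have "openin (top_of_set (UNIV::complex set)) ((G \<circ> k) ` h ` H)"
  proof (intro invariance_of_domain_sphere_affine_set[OF _ _ _ _ _ _ opS])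
    assume "h ` H \<subseteq> ?S"
    then show "continuous_on (h ` H) (G \<circ> k)"
      using h contG
      by (intro continuous_on_compose) (auto simp: homeomorphism_def intro: continuous_on_subset)
    show "inj_on (G \<circ> k) (h ` H)"
      by (intro comp_inj_on inj_on_inverseI[of _ h]) (use kh injG khH in auto)
  qed auto
  then have "open (G ` H)"
    using khH by (simp only: image_comp [symmetric] open_openin subtopology_UNIV)
  define q where "q = (\<lambda>v. if v = x \<or> v = y then 1/2 else 0 :: real)"
  have "q \<in> ?R"
    by (rule realizationI[OF xy(1)]) (use xy in \<open>auto simp: q_def\<close>)
  then have "q \<in> H"
    by (auto simp: H_def q_def)
  moreover have "G q = Complex (1/2) 0"
    using z by (auto simp: G_def q_def)
  ultimately have "Complex (1/2) 0 \<in> G ` H"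
    by (metis imageI)
  then obtain e where e: "e > 0" "ball (Complex (1/2) 0) e \<subseteq> G ` H"
    using \<open>open (G ` H)\<close> by (auto simp: open_contains_ball)
  \<comment> \<open>A point just across the boundary line; as a value of \<open>G\<close> it would
    give \<open>z\<close> a negative weight.\<close>
  have "Complex (1/2) (-e/2) \<in> ball (Complex (1/2) 0) e"
    using e by (auto simp: dist_complex_def cmod_def)
  then obtain p where "p \<in> H" "G p = Complex (1/2) (-e/2)"
    using e by auto
  then have "p z = - e / 2" "p z \<ge> 0"
    unfolding G_def H_def realization_def by (simp, blast)
  then show False
    using e(1) by simp
qed

text \<open>Purity supplies one triangle at the edge; exactly one and at least three are excluded by
  the two preceding lemmas.\<close>

lemma sphere_edge_in_two_triangles:
  fixes L :: "'v set set"
  assumes S: "combinatorial_2_sphere L" and xy: "{x,y} \<in> L" "x \<noteq> y"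
  shows "card {v. v \<notin> {x,y} \<and> {x,y,v} \<in> L} = 2"
proof -
  define N where "N = {v. v \<notin> {x,y} \<and> {x,y,v} \<in> L}"
  have L: "simplicial_complex L" "pure_dim L 2"
    using S by (auto simp: combinatorial_2_sphere_def)
  obtain h k where h: "homeomorphism (realization L) (sphere (0::real^3) 1) h k"
    using S by (auto simp: combinatorial_2_sphere_def homeomorphic_def)
  have "N \<subseteq> \<Union>L" "finite (\<Union>L)"
    using L by (auto simp: N_def simplicial_complex_def)
  then have fin: "finite N"
    by (rule finite_subset)
  obtain t where t: "t \<in> L" "{x,y} \<subseteq> t" "card t = 3"
    using L(2) xy unfolding pure_dim_def by (metis numeral_2_eq_2 Suc_eq_plus1 numeral_3_eq_3)
  have "card {x,y} < card t"
    using t xy by simp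
  then obtain z where z: "z \<in> t" "z \<notin> {x,y}"
    by (metis card_mono finite.emptyI finite_insert linorder_not_le subsetI)
  have "{x,y,z} \<in> L"
    using t z by (intro simplicial_complex_subset[OF L(1) t(1)]) auto
  then have zN: "z \<in> N"
    using z by (simp add: N_def)
  have "card N \<noteq> 0"
    using fin zN card_0_eq by blast
  moreover have "card N \<noteq> 1"
  proof
    assume "card N = 1"
    then have "N = {z}"
      using zN by (metis card_1_singletonE singletonD)
    then show False
      using sphere_edge_not_in_single_triangle[OF h L(1) xy, of z] z by (auto simp: N_def)
  qed
  moreover have "\<not> card N \<ge> 3"
  proof
    assume "card N \<ge> 3"
    then obtain T where "T \<subseteq> N" "card T = 3"
      by (meson obtain_subset_with_card_n)
    then obtain a b c where "{a,b,c} \<subseteq> N" "a \<noteq> b" "a \<noteq> c" "b \<noteq> c"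
      by (metis card_3_iff)
    then show False
      using sphere_edge_not_in_three_triangles[OF h L(1), of x y a b c] xy by (auto simp: N_def)
  qed
  ultimately show ?thesis unfolding N_def[symmetric] by linarith
qed

section \<open>Connectedness of the realization and three-cycles\<close>

lemma vertex_in_realization:
  "{w} \<in> K \<Longrightarrow> (\<lambda>v. if v = w then 1 else 0) \<in> realization K"
  by (rule realizationI[of "{w}"]) simp_all

text \<open>Along the straight segment to the vertex the support remains that of \<open>p\<close>
  and shrinks to \<open>{w}\<close> only at the end, hence the separate case \<open>t = 1\<close>;
  the weight of \<open>w\<close> stays positive throughout.\<close>

lemma realization_segment_to_vertex:
  fixes L :: "'v set set"
  assumes L: "simplicial_complex L" and p: "p \<in> realization L" "p w \<noteq> 0"
  shows "connected_component {q \<in> realization L. q w \<noteq> 0} p (\<lambda>v. if v = w then 1 else 0)"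
proof -
  let ?d = "\<lambda>v. if v = w then 1 else 0 :: real"
  define \<gamma> where "\<gamma> = (\<lambda>t v. (1 - t) * p v + t * ?d v)"
  let ?s = "{u. p u \<noteq> 0}"
  have pos: "0 \<le> p v" for v
    using p by (simp add: realization_def)
  have s: "?s \<in> L" "sum p ?s = 1" "w \<in> ?s"
    using p by (auto simp: realization_def)
  have fin: "finite ?s"
    using L s(1) unfolding simplicial_complex_def by blast
  have wL: "{w} \<in> L"
    using s(3) by (intro simplicial_complex_subset[OF L s(1)]) auto
  have pw: "0 < p w"
    using pos[of w] p by simp
  have mem: "\<gamma> t \<in> {q \<in> realization L. q w \<noteq> 0}" if t: "t \<in> {0..1}" for t
  proof (cases "t = 1")
    case True
    then have "\<gamma> t = ?d"
      by (simp add: \<gamma>_def)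
    then show ?thesis
      using vertex_in_realization[OF wL] by simp
  next
    case False
    then have t': "0 \<le> t" "t < 1"
      using t by auto
    have w: "0 < \<gamma> t w"
      unfolding \<gamma>_def using pw t' by (simp add: add_pos_nonneg)
    have "\<gamma> t v \<noteq> 0 \<longleftrightarrow> p v \<noteq> 0" for v
      using w t' pw by (cases "v = w") (auto simp: \<gamma>_def)
    then have "{u. \<gamma> t u \<noteq> 0} = ?s"
      by simp
    moreover have "0 \<le> \<gamma> t v" for v
      using t' pos by (simp add: \<gamma>_def)
    moreover have "sum (\<gamma> t) ?s = (1 - t) * sum p ?s + t * sum ?d ?s"
      by (simp add: \<gamma>_def sum.distrib sum_distrib_left)
    then have "sum (\<gamma> t) ?s = 1"
      using s fin by simp
    ultimately have "\<gamma> t \<in> realization L"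
      by (intro realizationI[OF s(1)])
    then show ?thesis
      using w by simp
  qed
  have "continuous_on {0..1} \<gamma>"
    unfolding \<gamma>_def by (rule continuous_on_coordinatewise_then_product) (intro continuous_intros)
  then have "connected (\<gamma> ` {0..1})"
    by (intro connected_continuous_image) auto
  moreover have "\<gamma> 0 = p" "\<gamma> 1 = ?d"
    by (auto simp: \<gamma>_def)
  then have "p \<in> \<gamma> ` {0..1}" "?d \<in> \<gamma> ` {0..1}"
    by (metis atLeastAtMost_iff image_eqI order_refl zero_le_one)+
  ultimately show ?thesis
    unfolding connected_component_def using mem by blast
qed

text \<open>As the triangle is missing but its edges are present, the coordinates at
  \<open>x\<close> and \<open>y\<close> identify these points with the boundary of a plane triangle,
  and the boundary of a convex body in the plane is a circle.\<close>

lemma missing_triangle_boundary_homeomorphic_circle: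
  fixes L :: "'v set set"
  assumes L: "simplicial_complex L" and dist: "distinct [x,y,z]"
    and edges: "{x,y} \<in> L" "{y,z} \<in> L" "{x,z} \<in> L" and no: "{x,y,z} \<notin> L"
  shows "{p \<in> realization L. {u. p u \<noteq> 0} \<subseteq> {x,y,z}} homeomorphic sphere (0::complex) 1"
proof -
  let ?C = "{p \<in> realization L. {u. p u \<noteq> 0} \<subseteq> {x,y,z}}"
  \<comment> \<open>The solid triangle with corners 0, 1 and i; \<open>T\<close> is its frontier
    written out in coordinates.\<close>
  define D where "D = convex hull (insert 0 Basis :: complex set)"
  define T where "T = {c. 0 \<le> Re c \<and> 0 \<le> Im c \<and> Re c + Im c \<le> 1 \<and>
    \<not> (0 < Re c \<and> 0 < Im c \<and> Re c + Im c < 1)}"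
  have intD: "interior D \<noteq> {}"
    unfolding D_def using interior_std_simplex_nonempty[where 'a = complex] by blast
  have bnd: "bounded D" "convex D" "closed D"
    unfolding D_def
    by (simp_all add: bounded_convex_hull compact_imp_closed compact_convex_hull
      finite_imp_compact finite_imp_bounded)
  have rfD: "rel_frontier D = frontier D"
    using intD by (intro rel_frontier_frontier affine_hull_nonempty_interior)
  have "rel_frontier D homeomorphic rel_frontier (cball (0::complex) 1)"
    using bnd intD
    by (intro homeomorphic_rel_frontiers_convex_bounded_sets) (auto simp: aff_dim_nonempty_interior aff_dim_cball)
  moreover have "frontier D = T"
  proof -
    have "frontier D = D - interior D"
      using bnd(3) by (simp add: frontier_def)
    then show ?thesis
      unfolding D_def interior_std_simplex unfolding std_simplex T_def
      by (auto simp: Basis_complex_def)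
  qed
  ultimately have T: "T homeomorphic sphere (0::complex) 1"
    using rfD by simp
  define \<Phi> where "\<Phi> = (\<lambda>p::'v \<Rightarrow> real. Complex (p x) (p y))"
  define \<Psi> where "\<Psi> = (\<lambda>c v. if v = x then Re c else if v = y then Im c
    else if v = z then 1 - Re c - Im c else 0)"
  have sum1: "p x + p y + p z = 1" and p0: "v \<notin> {x,y,z} \<Longrightarrow> p v = 0" and nn: "0 \<le> p v"
    and npos: "\<not> (0 < p x \<and> 0 < p y \<and> 0 < p z)"
    if p: "p \<in> ?C" for p v
  proof -
    let ?s = "{u. p u \<noteq> 0}"
    have "1 = sum p ?s"
      using p by (simp add: realization_def)
    also have "\<dots> = sum p {x,y,z}"
      using p by (intro sum.mono_neutral_left) auto
    finally show "p x + p y + p z = 1"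
      using dist by simp
    show "v \<notin> {x,y,z} \<Longrightarrow> p v = 0" "0 \<le> p v"
      using p by (auto simp: realization_def)
    show "\<not> (0 < p x \<and> 0 < p y \<and> 0 < p z)"
    proof
      assume "0 < p x \<and> 0 < p y \<and> 0 < p z"
      then have "?s = {x,y,z}"
        using p by auto
      then show False
        using p no by (simp add: realization_def)
    qed
  qed
  have \<Phi>T: "\<Phi> p \<in> T" if "p \<in> ?C" for p
    using sum1[OF that] nn[OF that, of x] nn[OF that, of y] nn[OF that, of z] npos[OF that]
    by (auto simp: \<Phi>_def T_def)
  have \<Psi>\<Phi>: "\<Psi> (\<Phi> p) = p" if "p \<in> ?C" for p
  proof
    fix v
    show "\<Psi> (\<Phi> p) v = p v"
      using sum1[OF that] p0[OF that, of v] by (auto simp: \<Phi>_def \<Psi>_def)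
  qed
  have \<Phi>\<Psi>: "\<Phi> (\<Psi> c) = c" for c
    using dist by (auto simp: \<Phi>_def \<Psi>_def)
  have \<Psi>C: "\<Psi> c \<in> ?C" if c: "c \<in> T" for c
  proof -
    let ?s = "{u. \<Psi> c u \<noteq> 0}"
    have sub: "?s \<subseteq> {x,y,z}"
      by (auto simp: \<Psi>_def)
    have sum: "sum (\<Psi> c) ?s = 1"
    proof -
      have "sum (\<Psi> c) ?s = sum (\<Psi> c) {x,y,z}"
        using sub by (intro sum.mono_neutral_left) auto
      also have "\<dots> = 1"
        using dist by (auto simp: \<Psi>_def)
      finally show ?thesis .
    qed
    then have ne: "?s \<noteq> {}"
      by (metis sum.empty zero_neq_one)
    have "\<Psi> c x = 0 \<or> \<Psi> c y = 0 \<or> \<Psi> c z = 0"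
      using c dist by (auto simp: \<Psi>_def T_def)
    then consider "?s \<subseteq> {y,z}" | "?s \<subseteq> {x,z}" | "?s \<subseteq> {x,y}"
      using sub by blast
    then have "?s \<in> L"
      using ne edges by cases (blast intro: simplicial_complex_subset[OF L])+
    moreover have "0 \<le> \<Psi> c v" for v
      using c by (auto simp: \<Psi>_def T_def)
    ultimately show ?thesis
      using sum sub by (simp add: realization_def)
  qed
  have "homeomorphism ?C T \<Phi> \<Psi>"
  proof (rule homeomorphismI)
    show "continuous_on ?C \<Phi>"
      unfolding \<Phi>_def Complex_eq by (intro continuous_intros continuous_on_coordinate)
    show "continuous_on T \<Psi>"
    proof (rule continuous_on_coordinatewise_then_product)
      show "continuous_on T (\<lambda>c. \<Psi> c v)" for v
        by (cases "v = x"; cases "v = y"; cases "v = z") (simp_all add: \<Psi>_def continuous_intros)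
    qed
  qed (use \<Phi>T \<Psi>C \<Phi>\<Psi> \<Psi>\<Phi> in blast)+
  then show ?thesis
    using T homeomorphic_def homeomorphic_trans by blast
qed

text \<open>If the triangle were missing, its edges would form a circle. Every point off this circle
  has positive weight at some vertex outside the cycle, so it is joined to that vertex and then
  along an edge to \<open>w\<close>; a connected complement contradicts the Jordan curve theorem.
  The vertex \<open>w\<close> is also the point off the curve that the separation lemma asks
  for.\<close>

lemma neighborly_sphere_three_cycle_bounds:
  fixes L :: "'v set set"
  assumes S: "combinatorial_2_sphere L"
    and nb: "\<And>u w. u \<in> \<Union>L \<Longrightarrow> w \<in> \<Union>L \<Longrightarrow> {u,w} \<in> L"
    and xyz: "x \<in> \<Union>L" "y \<in> \<Union>L" "z \<in> \<Union>L" "distinct [x,y,z]"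
    and w: "w \<in> \<Union>L" "w \<notin> {x,y,z}"
  shows "{x,y,z} \<in> L"
proof (rule ccontr)
  assume no: "{x,y,z} \<notin> L"
  let ?R = "realization L" and ?S = "sphere (0::real^3) 1"
  define C where "C = {p \<in> ?R. {u. p u \<noteq> 0} \<subseteq> {x,y,z}}"
  let ?d = "\<lambda>w v. if v = w then 1 else 0 :: real"
  have L: "simplicial_complex L"
    using S by (auto simp: combinatorial_2_sphere_def)
  obtain h k where h: "homeomorphism ?R ?S h k"
    using S by (auto simp: combinatorial_2_sphere_def homeomorphic_def)
  have circ: "C homeomorphic sphere (0::complex) 1"
    unfolding C_def using nb xyz no by (intro missing_triangle_boundary_homeomorphic_circle[OF L]) auto
  have to_vertex: "connected_component (?R - C) p (?d v)"
    if "p \<in> ?R" "p v \<noteq> 0" "v \<notin> {x,y,z}" for p v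
  proof (rule connected_component_of_subset[OF realization_segment_to_vertex[OF L that(1,2)]])
    show "{q \<in> ?R. q v \<noteq> 0} \<subseteq> ?R - C"
      using that(3) by (auto simp: C_def)
  qed
  have dw: "connected_component (?R - C) p (?d w)" if p: "p \<in> ?R - C" for p
  proof -
    obtain v where v: "p v \<noteq> 0" "v \<notin> {x,y,z}"
      using p by (auto simp: C_def)
    have pv: "connected_component (?R - C) p (?d v)"
      using p v by (intro to_vertex) auto
    show ?thesis
    proof (cases "v = w")
      case False
      have "v \<in> \<Union>L"
        using p v by (auto simp: realization_def)
      then have vw: "{v,w} \<in> L"
        using nb w by blast
      \<comment> \<open>The midpoint of the edge from \<open>v\<close> to \<open>w\<close> has
        positive weight at both ends, so it is joined to both vertices off the circle.\<close>
      define m where "m = (\<lambda>u. if u = v \<or> u = w then 1/2 else 0 :: real)"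
      have "m \<in> ?R"
        by (rule realizationI[OF vw]) (use False in \<open>auto simp: m_def\<close>)
      then have "connected_component (?R - C) m (?d v)" "connected_component (?R - C) m (?d w)"
        using v w by (auto intro!: to_vertex simp: m_def)
      then show ?thesis
        using pv by (meson connected_component_sym connected_component_trans)
    qed (use pv in simp)
  qed
  then have con: "connected (?R - C)"
    unfolding connected_iff_connected_component
    by (meson connected_component_sym connected_component_trans)
  have hS: "h ` ?R = ?S"
    using h by (simp add: homeomorphism_def)
  have inj: "inj_on h ?R"
    using h by (auto simp: homeomorphism_def intro: inj_on_inverseI)
  have "h ` (?R - C) = h ` ?R - h ` C"
    using inj by (intro inj_on_image_set_diff) (auto simp: C_def)
  then have hd: "h ` (?R - C) = ?S - h ` C"
    using hS by simp
  have "continuous_on (?R - C) h"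
    using h by (auto simp: homeomorphism_def intro: continuous_on_subset)
  then have conS: "connected (?S - h ` C)"
    unfolding hd[symmetric] using con by (rule connected_continuous_image)
  have "C homeomorphic h ` C"
  proof -
    have "homeomorphism C (h ` C) h k"
      using hS by (intro homeomorphism_of_subsets[OF h]) (auto simp: C_def)
    then show ?thesis
      using homeomorphic_def by blast
  qed
  then have "h ` C homeomorphic sphere (0::complex) 1"
    using circ homeomorphic_sym homeomorphic_trans by blast
  moreover have "{w} \<in> L"
    using nb[OF w(1) w(1)] by simp
  then have "?d w \<in> ?R"
    by (rule vertex_in_realization)
  then have "?d w \<in> ?R - C"
    using w by (auto simp: C_def)
  then have "h (?d w) \<in> ?S - h ` C"
    unfolding hd[symmetric] by (rule imageI)
  moreover have "h ` C \<subseteq> ?S"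
    using hS by (auto simp: C_def)
  ultimately show False
    using conS simple_closed_curve_separates_2_sphere by blast
qed

text \<open>A set of vertices closed under adjacency and its complement yield two disjoint unions of
  open vertex stars that cover the connected realization. This will keep all vertices of a link on
  one side of the level.\<close>

lemma sphere_vertices_connected:
  fixes L :: "'v set set"
  assumes S: "combinatorial_2_sphere L"
    and v: "v \<in> \<Union>L" "v \<in> W"
    and step: "\<And>u w. {u,w} \<in> L \<Longrightarrow> u \<in> W \<Longrightarrow> w \<in> W"
  shows "\<Union>L \<subseteq> W"
proof (rule ccontr)
  let ?R = "realization L"
  define P where "P = (\<lambda>V. \<Union>u\<in>V. {p::'v \<Rightarrow> real. p u \<noteq> 0})"
  assume "\<not> \<Union>L \<subseteq> W"
  then obtain w where w: "w \<in> \<Union>L" "w \<notin> W" by blast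
  have L: "simplicial_complex L"
    using S by (auto simp: combinatorial_2_sphere_def)
  have "connected (sphere (0::real^3) 1)"
    by (rule connected_sphere) simp
  then have conn: "connected ?R"
    using S homeomorphic_connectedness unfolding combinatorial_2_sphere_def by blast
  have P: "p \<in> P V \<longleftrightarrow> (\<exists>u\<in>V. p u \<noteq> 0)" for p V
    by (simp add: P_def)
  have op: "open (P V)" for V
    unfolding P_def by (intro open_UN ballI open_Collect_neq continuous_on_coordinate continuous_on_const)
  have vert: "P V \<inter> ?R \<noteq> {}" if "u \<in> \<Union>L" "u \<in> V" for u V
  proof -
    have "{u} \<in> L"
      using that simplicial_complex_subset[OF L] by blast
    then have "(\<lambda>v. if v = u then 1 else 0) \<in> ?R"
      by (rule vertex_in_realization)
    moreover have "(\<lambda>v. if v = u then 1 else 0) \<in> P V"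
      using that(2) by (simp add: P)
    ultimately show ?thesis
      by blast
  qed
  have "P W \<inter> P (- W) \<inter> ?R = {}"
  proof (rule ccontr)
    assume "P W \<inter> P (- W) \<inter> ?R \<noteq> {}"
    then obtain p a b where p: "p \<in> ?R" "p a \<noteq> 0" "p b \<noteq> 0" "a \<in> W" "b \<notin> W"
      by (auto simp: P)
    then have "{u. p u \<noteq> 0} \<in> L"
      by (simp add: realization_def)
    then have "{a,b} \<in> L"
      by (rule simplicial_complex_subset[OF L]) (use p in auto)
    then show False
      using step p by blast
  qed
  moreover have "?R \<subseteq> P W \<union> P (- W)"
  proof
    fix p assume "p \<in> ?R"
    then have "sum p {u. p u \<noteq> 0} = 1"
      by (simp add: realization_def)
    then have "{u. p u \<noteq> 0} \<noteq> {}"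
      by (metis sum.empty zero_neq_one)
    then obtain u where "p u \<noteq> 0"
      by blast
    then show "p \<in> P W \<union> P (- W)"
      by (cases "u \<in> W") (auto simp: P)
  qed
  ultimately have "P W \<inter> ?R = {} \<or> P (- W) \<inter> ?R = {}"
    using connectedD[OF conn op op] by blast
  then show False
    using vert v w by (metis ComplI)
qed

subsection \<open>Product models\<close>

text \<open>A model of a slice in which every lower vertex (\<open>I\<close>) is joined to every
  upper one (\<open>J\<close>): a crossing simplex with lower part \<open>P\<close> and upper part
  \<open>Q\<close> is cut in the cell \<open>P \<times> Q\<close>. All crossing triangles are
  present; \<open>R\<close> lists the shapes (lower count, upper count) of the tetrahedra, and all
  sets of a listed shape occur.\<close>

definition product_map :: "'a set \<Rightarrow> 'b set \<Rightarrow> (nat \<times> nat) set \<Rightarrow> ('a \<times> 'b) pcomplex" where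
  "product_map I J R = (I \<times> J,
     {P \<times> Q | P Q. P \<subseteq> I \<and> Q \<subseteq> J \<and> (card P, card Q) \<in> {(1,2),(2,1)}},
     {P \<times> Q | P Q. P \<subseteq> I \<and> Q \<subseteq> J \<and> (card P, card Q) \<in> R})"

lemma comb_iso_trans: "comb_iso S T \<Longrightarrow> comb_iso T U \<Longrightarrow> comb_iso S U"
proof (cases S, cases T, cases U)
  fix V E F V' E' F' V'' E'' F''
  assume eq: "S = (V, E, F)" "T = (V', E', F')" "U = (V'', E'', F'')"
  assume "comb_iso S T" "comb_iso T U"
  then obtain \<phi> \<psi> where
    "bij_betw \<phi> V V'" "(\<lambda>e. \<phi> ` e) ` E = E'" "(\<lambda>e. \<phi> ` e) ` F = F'"
    "bij_betw \<psi> V' V''" "(\<lambda>e. \<psi> ` e) ` E' = E''" "(\<lambda>e. \<psi> ` e) ` F' = F''"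
    by (auto simp: comb_iso_def eq)
  then have "bij_betw (\<psi> \<circ> \<phi>) V V''" "(\<lambda>e. (\<psi> \<circ> \<phi>) ` e) ` E = E''"
    "(\<lambda>e. (\<psi> \<circ> \<phi>) ` e) ` F = F''"
    by (blast intro: bij_betw_trans, auto simp: image_comp comp_def)
  then show "comb_iso S U"
    unfolding comb_iso_def eq prod.case by blast
qed

text \<open>An isomorphism is bijective on \<open>V\<close> only; the inclusions \<open>sub\<close>
  let its inverse cancel it on whole cells.\<close>

lemma comb_iso_sym:
  assumes "comb_iso (V, E, F) T" and sub: "\<Union>E \<subseteq> V" "\<Union>F \<subseteq> V"
  shows "comb_iso T (V, E, F)"
proof (cases T)
  fix V' E' F'
  assume eq: "T = (V', E', F')"
  obtain \<phi> where \<phi>: "bij_betw \<phi> V V'" "(\<lambda>e. \<phi> ` e) ` E = E'" "(\<lambda>e. \<phi> ` e) ` F = F'"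
    using assms(1) by (auto simp: comb_iso_def eq)
  define \<psi> where "\<psi> = inv_into V \<phi>"
  have canc: "\<psi> ` \<phi> ` e = e" if "e \<subseteq> V" for e
    unfolding \<psi>_def using \<phi>(1) that by (intro inv_into_image_cancel) (auto simp: bij_betw_def)
  have "bij_betw \<psi> V' V"
    unfolding \<psi>_def using \<phi>(1) by (rule bij_betw_inv_into)
  moreover have inv: "(\<lambda>e. \<psi> ` e) ` X' = X" if "(\<lambda>e. \<phi> ` e) ` X = X'" "\<Union>X \<subseteq> V" for X X'
  proof -
    have "(\<lambda>e. \<psi> ` e) ` X' = (\<lambda>e. \<psi> ` \<phi> ` e) ` X"
      using that(1) by (auto simp: image_image)
    also have "\<dots> = (\<lambda>e. e) ` X"
      by (rule image_cong) (use canc that(2) in auto)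
    finally show ?thesis by simp
  qed
  ultimately show ?thesis
    unfolding comb_iso_def eq prod.case 
    using inv[OF \<phi>(2) sub(1)] inv[OF \<phi>(3) sub(2)] by (intro exI[of _ \<psi>] conjI)
qed

lemma product_map_cong:
  assumes g: "bij_betw g I I'" and k: "bij_betw k J J'"
  shows "comb_iso (product_map I J R) (product_map I' J' R)"
proof -
  let ?\<phi> = "map_prod g k"
  have img: "(\<lambda>e. ?\<phi> ` e) ` {P \<times> Q | P Q. P \<subseteq> I \<and> Q \<subseteq> J \<and> (card P, card Q) \<in> X} =
    {P \<times> Q | P Q. P \<subseteq> I' \<and> Q \<subseteq> J' \<and> (card P, card Q) \<in> X}" (is "?l = ?r") for X
  proof
    show "?l \<subseteq> ?r"
    proof
      fix Y assume "Y \<in> ?l"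
      then obtain P Q where PQ: "P \<subseteq> I" "Q \<subseteq> J" "(card P, card Q) \<in> X" "Y = ?\<phi> ` (P \<times> Q)"
        by auto
      have "card (g ` P) = card P" "card (k ` Q) = card Q"
        using g k PQ by (auto intro!: card_image simp: bij_betw_def intro: inj_on_subset)
      moreover have "g ` P \<subseteq> I'" "k ` Q \<subseteq> J'"
        using g k PQ by (auto simp: bij_betw_def)
      moreover have "Y = g ` P \<times> k ` Q"
        using PQ by (simp add: map_prod_surj_on)
      ultimately show "Y \<in> ?r"
        using PQ(3) by (intro CollectI exI[of _ "g ` P"] exI[of _ "k ` Q"]) simp
    qed
    show "?r \<subseteq> ?l"
    proof
      fix Y assume "Y \<in> ?r"
      then obtain P' Q' where PQ: "P' \<subseteq> I'" "Q' \<subseteq> J'" "(card P', card Q') \<in> X" "Y = P' \<times> Q'"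
        by auto
      obtain P Q where P: "P \<subseteq> I" "P' = g ` P" and Q: "Q \<subseteq> J" "Q' = k ` Q"
        using PQ g k by (metis bij_betw_imp_surj_on subset_imageE)
      have "card P' = card P" "card Q' = card Q"
        using g k P Q by (auto intro!: card_image simp: bij_betw_def intro: inj_on_subset)
      moreover have "Y = ?\<phi> ` (P \<times> Q)"
        using PQ P Q by (simp add: map_prod_surj_on)
      ultimately show "Y \<in> ?l"
        using P Q PQ(3)
        by (intro image_eqI[where x = "P \<times> Q"] CollectI exI[of _ P] exI[of _ Q]) simp_all
    qed
  qed
  have "bij_betw ?\<phi> (I \<times> J) (I' \<times> J')"
    using g k by (rule bij_betw_map_prod)
  then show ?thesis
    unfolding comb_iso_def product_map_def prod.case by (intro exI[of _ ?\<phi>] conjI img)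
qed

text \<open>Any two of three cyclically ordered points are neighbours. This turns subsets of size
  two into the successor form used in \<open>torus_3x3\<close>.\<close>

lemma two_subsets_of_three: "P \<subseteq> {0..<3::nat} \<and> card P = 2 \<longleftrightarrow> (\<exists>i<3. P = {i, (i + 1) mod 3})"
proof
  assume P: "P \<subseteq> {0..<3} \<and> card P = 2"
  then obtain a b where ab: "P = {a,b}" "a \<noteq> b"
    by (auto simp: card_2_iff)
  then have "a = 0 \<or> a = 1 \<or> a = 2" "b = 0 \<or> b = 1 \<or> b = 2"
    using P by auto
  then have "b = (a + 1) mod 3 \<or> a = (b + 1) mod 3"
    using ab by auto
  then show "\<exists>i<3. P = {i, (i + 1) mod 3}"
    using ab P by auto
next
  assume "\<exists>i<3. P = {i, (i + 1) mod 3}"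
  then obtain i where i: "i < 3" "P = {i, (i + 1) mod 3}" by auto
  have "i \<noteq> (i + 1) mod 3"
    using i(1) by presburger
  then show "P \<subseteq> {0..<3} \<and> card P = 2"
    using i by auto
qed

lemma singleton_subsets: "P \<subseteq> {0..<n::nat} \<and> card P = 1 \<longleftrightarrow> (\<exists>i<n. P = {i})"
  by (auto simp: card_1_singleton_iff)

lemma product_map_torus: "product_map {0..<3} {0..<3} {(2,2)} = torus_3x3"
proof -
  have "{P \<times> Q | P Q. P \<subseteq> {0..<3::nat} \<and> Q \<subseteq> {0..<3::nat} \<and> (card P, card Q) \<in> {(1,2),(2,1)}} =
     {{(i,j),((i+1) mod 3, j)} | i j. i < 3 \<and> j < 3} \<union>
     {{(i,j),(i, (j+1) mod 3)} | i j. i < 3 \<and> j < 3}" (is "?l = ?r")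
  proof -
    have "?l = {P \<times> Q | P Q. (P \<subseteq> {0..<3} \<and> card P = 2) \<and> (Q \<subseteq> {0..<3} \<and> card Q = 1)} \<union>
      {P \<times> Q | P Q. (P \<subseteq> {0..<3} \<and> card P = 1) \<and> (Q \<subseteq> {0..<3} \<and> card Q = 2)}"
      by blast
    also have "\<dots> = {{i,(i+1) mod 3} \<times> {j} | i j. i < 3 \<and> j < 3} \<union>
      {{i} \<times> {j,(j+1) mod 3} | i j. i < 3 \<and> j < 3}"
      unfolding two_subsets_of_three singleton_subsets
      by (intro arg_cong2[where f = "(\<union>)"] Collect_cong; metis)
    also have "\<dots> = ?r"
      by simp
    finally show ?thesis .
  qed
  moreover have "{P \<times> Q | P Q. P \<subseteq> {0..<3::nat} \<and> Q \<subseteq> {0..<3::nat} \<and> (card P, card Q) \<in> {(2,2)}} =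
     {{(i,j),((i+1) mod 3, j),((i+1) mod 3,(j+1) mod 3),(i,(j+1) mod 3)} | i j. i < 3 \<and> j < 3}"
    (is "?l = ?r")
  proof -
    have "?l = {P \<times> Q | P Q. (P \<subseteq> {0..<3} \<and> card P = 2) \<and> (Q \<subseteq> {0..<3} \<and> card Q = 2)}"
      by blast
    also have "\<dots> = {{i,(i+1) mod 3} \<times> {j,(j+1) mod 3} | i j. i < 3 \<and> j < 3}"
      unfolding two_subsets_of_three by (intro Collect_cong; metis)
    also have "\<dots> = ?r"
      by (simp add: insert_commute)
    finally show ?thesis .
  qed
  ultimately show ?thesis
    by (simp only: product_map_def torus_3x3_def)
qed

text \<open>With a single lower vertex, projection to the upper vertex is an isomorphism.\<close>

lemma product_map_tetra: "comb_iso (product_map {0..<1::nat} {0..<4::nat} {(1,3)}) tetra_boundary"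
proof -
  \<comment> \<open>\<open>P\<close> can only be empty or \<open>{0}\<close>. The conditions on
    \<open>X\<close> exclude the former and force \<open>Q\<close> to have size \<open>n\<close>, so
    edges and faces are handled together.\<close>
  have img: "(\<lambda>e. snd ` e) ` {P \<times> Q | P Q. P \<subseteq> {0..<1::nat} \<and> Q \<subseteq> {0..<4::nat} \<and> (card P, card Q) \<in> X} =
    {A. A \<subseteq> {0..<4} \<and> card A = n}" (is "?l = ?r")
    if X: "(1, n) \<in> X" "\<And>m. (1, m) \<in> X \<Longrightarrow> m = n" "\<And>m. (0, m) \<notin> X" for X n
  proof
    show "?l \<subseteq> ?r"
    proof
      fix Y assume "Y \<in> ?l"
      then obtain P Q where PQ: "P \<subseteq> {0..<1::nat}" "Q \<subseteq> {0..<4}" "(card P, card Q) \<in> X"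
        "Y = snd ` (P \<times> Q)"
        by auto
      then have "P = {} \<or> P = {0}" by auto
      then have P: "P = {0}"
        using PQ(3) X(3) by auto
      then have "card Q = n"
        using PQ(3) X(2) by simp
      moreover have "Y = Q"
        using PQ(4) P by simp
      ultimately show "Y \<in> ?r"
        using PQ(2) by simp
    qed
    show "?r \<subseteq> ?l"
    proof
      fix Q assume "Q \<in> ?r"
      then show "Q \<in> ?l"
        using X(1) by (intro image_eqI[where x = "{0} \<times> Q"] CollectI exI[of _ "{0}"] exI[of _ Q]) simp_all
    qed
  qed
  have "bij_betw snd ({0..<1::nat} \<times> {0..<4::nat}) {0..<4}"
    by (auto simp: bij_betw_def inj_on_def image_iff)
  moreover have "(\<lambda>e. snd ` e) ` {P \<times> Q | P Q. P \<subseteq> {0..<1::nat} \<and> Q \<subseteq> {0..<4::nat} \<and>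
      (card P, card Q) \<in> {(1,2),(2,1)}} = {A. A \<subseteq> {0..<4} \<and> card A = 2}"
    by (rule img) auto
  moreover have "(\<lambda>e. snd ` e) ` {P \<times> Q | P Q. P \<subseteq> {0..<1::nat} \<and> Q \<subseteq> {0..<4::nat} \<and>
      (card P, card Q) \<in> {(1,3)}} = {A. A \<subseteq> {0..<4} \<and> card A = 3}"
    by (rule img) auto
  ultimately show ?thesis
    unfolding comb_iso_def product_map_def tetra_boundary_def prod.case
    by (intro exI[of _ snd] conjI)
qed

lemma ex_less_2: "(\<exists>i<2::nat. P i) \<longleftrightarrow> P 0 \<or> P 1"
  by (auto simp: less_2_cases_iff)

lemma ex_less_3: "(\<exists>i<3::nat. P i) \<longleftrightarrow> P 0 \<or> P 1 \<or> P 2"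
  by (auto simp: numeral_3_eq_3 less_Suc_eq numeral_2_eq_2)

lemma full_subset: "P \<subseteq> {0..<n::nat} \<and> card P = n \<longleftrightarrow> P = {0..<n}"
  by (metis card_atLeastLessThan card_subset_eq diff_zero finite_atLeastLessThan subset_refl)

lemma product_map_prism: "comb_iso (product_map {0..<2::nat} {0..<3::nat} {(2,2),(1,3)}) prism_boundary"
proof -
  \<comment> \<open>Numbers the bottom triangle 0, 1, 2 and the top triangle 3, 4, 5, as in
    \<open>prism_boundary\<close>.\<close>
  let ?\<phi> = "\<lambda>(i, j). 3 * i + j :: nat"
  have n2: "{0..<2} = {0,1::nat}" and n3: "{0..<3} = {0,1,2::nat}" and n6: "{0..<6} = {0,1,2,3,4,5::nat}"
    by auto
  have m: "(0 + 1) mod 3 = (1::nat)" "(1 + 1) mod 3 = (2::nat)" "(2 + 1) mod 3 = (0::nat)"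
    by simp_all
  have E: "{P \<times> Q | P Q. P \<subseteq> {0..<2::nat} \<and> Q \<subseteq> {0..<3::nat} \<and> (card P, card Q) \<in> {(1,2),(2,1)}} =
    {{0}\<times>{0,1},{0}\<times>{1,2},{0}\<times>{2,0},{1}\<times>{0,1},{1}\<times>{1,2},{1}\<times>{2,0},
     {0,1}\<times>{0},{0,1}\<times>{1},{0,1}\<times>{2}}" (is "?l = ?r")
  proof -
    have "?l = {Y. \<exists>P. (P \<subseteq> {0..<2} \<and> card P = 1) \<and> (\<exists>Q. (Q \<subseteq> {0..<3} \<and> card Q = 2) \<and> Y = P \<times> Q)} \<union>
      {Y. \<exists>P. (P \<subseteq> {0..<2} \<and> card P = 2) \<and> (\<exists>Q. (Q \<subseteq> {0..<3} \<and> card Q = 1) \<and> Y = P \<times> Q)}"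
      by blast
    also have "\<dots> = {Y. \<exists>i<2. \<exists>j<3. Y = {i} \<times> {j, (j+1) mod 3}} \<union> {Y. \<exists>j<3. Y = {0..<2} \<times> {j}}"
      unfolding two_subsets_of_three singleton_subsets full_subset by blast
    also have "\<dots> = ?r"
      unfolding ex_less_2 ex_less_3 n2 m
      by (rule set_eqI) (simp only: mem_Collect_eq Un_iff insert_iff empty_iff disj_assoc simp_thms)
    finally show ?thesis .
  qed
  have F: "{P \<times> Q | P Q. P \<subseteq> {0..<2::nat} \<and> Q \<subseteq> {0..<3::nat} \<and> (card P, card Q) \<in> {(2,2),(1,3)}} =
    {{0}\<times>{0,1,2},{1}\<times>{0,1,2},{0,1}\<times>{0,1},{0,1}\<times>{1,2},{0,1}\<times>{2,0}}" (is "?l = ?r")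
  proof -
    have "?l = {Y. \<exists>P. (P \<subseteq> {0..<2} \<and> card P = 1) \<and> (\<exists>Q. (Q \<subseteq> {0..<3} \<and> card Q = 3) \<and> Y = P \<times> Q)} \<union>
      {Y. \<exists>P. (P \<subseteq> {0..<2} \<and> card P = 2) \<and> (\<exists>Q. (Q \<subseteq> {0..<3} \<and> card Q = 2) \<and> Y = P \<times> Q)}"
      by blast
    also have "\<dots> = {Y. \<exists>i<2. Y = {i} \<times> {0..<3}} \<union> {Y. \<exists>j<3. Y = {0..<2} \<times> {j, (j+1) mod 3}}"
      unfolding two_subsets_of_three singleton_subsets full_subset by blast
    also have "\<dots> = ?r"
      unfolding ex_less_2 ex_less_3 n2 n3 m
      by (rule set_eqI) (simp only: mem_Collect_eq Un_iff insert_iff empty_iff disj_assoc simp_thms)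
    finally show ?thesis .
  qed
  have "bij_betw ?\<phi> ({0..<2} \<times> {0..<3}) {0..<6}"
    unfolding n2 n3 n6 by (auto simp: bij_betw_def inj_on_def)
  moreover have "(\<lambda>e. ?\<phi> ` e) ` {{0}\<times>{0,1},{0}\<times>{1,2},{0}\<times>{2,0},{1}\<times>{0,1},{1}\<times>{1,2},{1}\<times>{2,0},
      {0,1}\<times>{0},{0,1}\<times>{1},{0,1}\<times>{2}} =
    {{0,1},{1,2},{0,2},{3,4},{4,5},{3,5},{0,3},{1,4},{2,5}}"
    by (simp add: insert_commute numeral_2_eq_2)
  moreover have "(\<lambda>e. ?\<phi> ` e) ` {{0}\<times>{0,1,2},{1}\<times>{0,1,2},{0,1}\<times>{0,1},{0,1}\<times>{1,2},{0,1}\<times>{2,0}} =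
    {{0,1,2},{3,4,5},{0,1,4,3},{1,2,5,4},{2,0,3,5}}"
    by (simp add: insert_commute numeral_2_eq_2)
  ultimately show ?thesis
    unfolding comb_iso_def product_map_def prism_boundary_def prod.case E F
    by (intro exI[of _ ?\<phi>] conjI)
qed

subsection \<open>Slicings\<close>

definition lower :: "'v set set \<Rightarrow> ('v \<Rightarrow> real) \<Rightarrow> real \<Rightarrow> 'v set" where
  "lower M f x = {a. f a < x \<and> (\<exists>b. x < f b \<and> {a,b} \<in> M)}"

definition upper :: "'v set set \<Rightarrow> ('v \<Rightarrow> real) \<Rightarrow> real \<Rightarrow> 'v set" where
  "upper M f x = {b. x < f b \<and> (\<exists>a. f a < x \<and> {a,b} \<in> M)}"

text \<open>Negating \<open>f\<close> and the level exchanges lower and upper vertices but keeps the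
  slice, so each asymmetric case has to be treated only once.\<close>

lemma slicing_uminus: "slicing M (\<lambda>v. - f v) (- x) = slicing M f x"
proof -
  have "crossing (\<lambda>v. - f v) (- x) = crossing f x"
    by (auto simp: crossing_def fun_eq_iff)
  then show ?thesis
    by (simp add: slicing_def slice_vertices_def)
qed

lemma lower_uminus: "lower M (\<lambda>v. - f v) (- x) = upper M f x"
  by (auto simp: lower_def upper_def insert_commute)

lemma upper_uminus: "upper M (\<lambda>v. - f v) (- x) = lower M f x"
  by (auto simp: lower_def upper_def insert_commute)

lemma slice_vertices_eq: "slice_vertices M f x = {{a,b} | a b. {a,b} \<in> M \<and> f a < x \<and> x < f b}"
proof (intro set_eqI iffI)
  fix e assume "e \<in> slice_vertices M f x"
  then obtain u w where e: "e \<in> M" "card e = 2" "u \<in> e" "w \<in> e" "f u < x" "x < f w"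
    by (auto simp: slice_vertices_def crossing_def)
  then have "u \<noteq> w" by auto
  then have "e = {u,w}"
    using e by (auto simp: card_2_iff)
  then show "e \<in> {{a,b} | a b. {a,b} \<in> M \<and> f a < x \<and> x < f b}"
    using e by blast
next
  fix e assume "e \<in> {{a,b} | a b. {a,b} \<in> M \<and> f a < x \<and> x < f b}"
  then obtain a b where "e = {a,b}" "e \<in> M" "f a < x" "x < f b"
    by blast
  moreover then have "a \<noteq> b" by auto
  ultimately show "e \<in> slice_vertices M f x"
    by (auto simp: slice_vertices_def crossing_def)
qed

text \<open>In the link of \<open>z\<close> the triangle becomes the edge \<open>{x,y}\<close>, and
  the tetrahedra around the triangle become the triangles at that edge.\<close>

lemma triangle_in_two_tetrahedra:
  assumes M: "combinatorial_3_manifold M" and t: "{x,y,z} \<in> M" "distinct [x,y,z]"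
  shows "card {v. v \<notin> {x,y,z} \<and> {x,y,z,v} \<in> M} = 2"
proof -
  have sc: "simplicial_complex M"
    using M by (simp add: combinatorial_3_manifold_def)
  have "z \<in> cvertices M"
    using t(1) unfolding cvertices_def by blast
  then have S: "combinatorial_2_sphere (link M z)"
    using M by (simp add: combinatorial_3_manifold_def)
  have link_iff: "\<sigma> \<in> link M z \<longleftrightarrow> z \<notin> \<sigma> \<and> insert z \<sigma> \<in> M" if "\<sigma> \<noteq> {}" for \<sigma>
    using that simplicial_complex_subset[OF sc, of "insert z \<sigma>" \<sigma>] by (auto simp: link_def)
  have xy: "{x,y} \<in> link M z"
    using t by (auto simp: link_iff insert_commute)
  have "{v. v \<notin> {x,y} \<and> {x,y,v} \<in> link M z} = {v. v \<notin> {x,y,z} \<and> {x,y,z,v} \<in> M}"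
    using t by (auto simp: link_iff insert_commute)
  then show ?thesis
    using sphere_edge_in_two_triangles[OF S xy] t by simp
qed

text \<open>No vertex value equals \<open>x\<close>, so each vertex of \<open>t\<close> lies
  strictly on one side, and within \<open>t\<close> it is joined to a vertex on the other
  side.\<close>

lemma crossing_parts:
  assumes sc: "simplicial_complex M" and x: "x \<notin> f ` cvertices M"
    and t: "t \<in> M" "crossing f x t"
  shows "t \<subseteq> lower M f x \<union> upper M f x"
proof
  fix v assume v: "v \<in> t"
  obtain u w where uw: "u \<in> t" "f u < x" "w \<in> t" "x < f w"
    using t by (auto simp: crossing_def)
  have "{v,w} \<in> M" "{u,v} \<in> M"
    using v uw by (intro simplicial_complex_subset[OF sc t(1)]; auto)+
  moreover have "f v \<noteq> x"
    using x v t by (auto simp: cvertices_def)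
  ultimately show "v \<in> lower M f x \<union> upper M f x"
    using uw by (auto simp: lower_def upper_def not_less_iff_gr_or_eq)
qed

section \<open>Weak neighborliness and the product structure of the slice\<close>

lemma weakly_neighborly_common_simplex:
  assumes "weakly_neighborly (slicing M f x)"
    and "e \<in> slice_vertices M f x" "e' \<in> slice_vertices M f x"
  obtains t where "t \<in> M" "e \<subseteq> t" "e' \<subseteq> t"
proof -
  have "\<exists>Y\<in>{{e \<in> slice_vertices M f x. e \<subseteq> t} | t. t \<in> M \<and> card t = 4 \<and> crossing f x t}.
    e \<in> Y \<and> e' \<in> Y"
    using assms(1)[unfolded weakly_neighborly_def slicing_def prod.case, rule_format, OF assms(2,3)] .
  then show thesis
    using that by blast
qed

text \<open>Neighborliness is applied twice: first to some crossing edge at \<open>a\<close> and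
  some crossing edge at \<open>b\<close>, which shows that \<open>{a,b}\<close> is itself a crossing
  edge, then to \<open>{a,b}\<close> and \<open>{a',b'}\<close>. The vertices may coincide, so
  triangles are covered as well.\<close>

lemma weakly_neighborly_complete:
  assumes sc: "simplicial_complex M" and wn: "weakly_neighborly (slicing M f x)"
    and a: "a \<in> lower M f x" "a' \<in> lower M f x" and b: "b \<in> upper M f x" "b' \<in> upper M f x"
  shows "{a,a',b,b'} \<in> M"
proof -
  have edge: "{a,b} \<in> slice_vertices M f x" if ab: "a \<in> lower M f x" "b \<in> upper M f x" for a b
  proof -
    obtain b1 a1 where "{a,b1} \<in> slice_vertices M f x" "{a1,b} \<in> slice_vertices M f x"
      using ab unfolding slice_vertices_eq lower_def upper_def by blast
    then obtain t where "t \<in> M" "{a,b1} \<subseteq> t" "{a1,b} \<subseteq> t"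
      using weakly_neighborly_common_simplex[OF wn] by metis
    then have "{a,b} \<in> M"
      by (elim simplicial_complex_subset[OF sc]) auto
    then show ?thesis
      using ab unfolding slice_vertices_eq lower_def upper_def by blast
  qed
  obtain t where "t \<in> M" "{a,b} \<subseteq> t" "{a',b'} \<subseteq> t"
    using weakly_neighborly_common_simplex[OF wn edge edge] a b by metis
  then show ?thesis
    by (elim simplicial_complex_subset[OF sc]) auto
qed

lemma card_1_or_2E:
  assumes "card P = 1 \<or> card P = 2"
  obtains a a' where "P = {a,a'}"
  using assms by (metis card_1_singletonE card_2_iff insert_absorb2)

text \<open>Sending \<open>(a,b)\<close> to the edge \<open>{a,b}\<close> identifies the grid of
  lower and upper vertices with the slice vertices. The remaining freedom lies in the tetrahedra,
  and \<open>R\<close> assumes that their presence depends on shape alone.\<close>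

lemma slicing_comb_iso_product_map:
  fixes M :: "'v set set"
  assumes sc: "simplicial_complex M" and x: "x \<notin> f ` cvertices M"
    and wn: "weakly_neighborly (slicing M f x)"
    and R0: "R \<subseteq> {(1,3),(2,2),(3,1)}"
    and R: "\<And>P Q. P \<subseteq> lower M f x \<Longrightarrow> Q \<subseteq> upper M f x \<Longrightarrow>
      (card P, card Q) \<in> {(1,3),(2,2),(3,1)} \<Longrightarrow> P \<union> Q \<in> M \<longleftrightarrow> (card P, card Q) \<in> R"
  shows "comb_iso (slicing M f x) (product_map (lower M f x) (upper M f x) R)"
proof -
  let ?A = "lower M f x" and ?B = "upper M f x" and ?V = "slice_vertices M f x"
  let ?\<phi> = "\<lambda>(a,b). {a,b} :: 'v set"
  have A: "f a < x" if "a \<in> ?A" for a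
    using that by (simp add: lower_def)
  have B: "x < f b" if "b \<in> ?B" for b
    using that by (simp add: upper_def)
  have AB: "{a,b} \<in> M" if "a \<in> ?A" "b \<in> ?B" for a b
    using weakly_neighborly_complete[OF sc wn that(1,1) that(2,2)] by simp
  have V: "?V = {{a,b} | a b. a \<in> ?A \<and> b \<in> ?B}"
  proof -
    have "{a,b} \<in> M \<and> f a < x \<and> x < f b \<longleftrightarrow> a \<in> ?A \<and> b \<in> ?B" for a b
    proof
      assume "{a,b} \<in> M \<and> f a < x \<and> x < f b"
      then show "a \<in> ?A \<and> b \<in> ?B"
        unfolding lower_def upper_def by blast
    qed (use AB A B in simp)
    then show ?thesis
      unfolding slice_vertices_eq by simp
  qed
  \<comment> \<open>Lower and upper vertices are separated by \<open>f\<close>, so a slice vertex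
    contained in \<open>P \<union> Q\<close> has its lower end in \<open>P\<close> and its upper end
    in \<open>Q\<close>.\<close>
  have ph: "?\<phi> ` (P \<times> Q) = {e \<in> ?V. e \<subseteq> P \<union> Q}" if "P \<subseteq> ?A" "Q \<subseteq> ?B" for P Q
  proof -
    have mem: "a \<in> P \<and> b \<in> Q" if "{a,b} \<subseteq> P \<union> Q" "a \<in> ?A" "b \<in> ?B" for a b
      using that \<open>P \<subseteq> ?A\<close> \<open>Q \<subseteq> ?B\<close> A[of a] B[of b] A[of b] B[of a] by auto
    show ?thesis
    proof (intro equalityI subsetI)
      fix e assume "e \<in> ?\<phi> ` (P \<times> Q)"
      then obtain a b where "a \<in> P" "b \<in> Q" "e = {a,b}"
        by blast
      then show "e \<in> {e \<in> ?V. e \<subseteq> P \<union> Q}"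
        unfolding V using that by blast
    next
      fix e assume "e \<in> {e \<in> ?V. e \<subseteq> P \<union> Q}"
      then obtain a b where ab: "a \<in> ?A" "b \<in> ?B" "{a,b} \<subseteq> P \<union> Q" "e = ?\<phi> (a,b)"
        unfolding V by auto
      then have "(a,b) \<in> P \<times> Q"
        using mem by blast
      then show "e \<in> ?\<phi> ` (P \<times> Q)"
        using ab(4) by (rule rev_image_eqI)
    qed
  qed
  \<comment> \<open>Treats slice edges (\<open>n = 3\<close>) and slice faces (\<open>n = 4\<close>)
    at once; \<open>X\<close> is the set of admissible shapes.\<close>
  have faces: "(\<lambda>e. ?\<phi> ` e) ` {P \<times> Q | P Q. P \<subseteq> ?A \<and> Q \<subseteq> ?B \<and> (card P, card Q) \<in> X} =
     {{e \<in> ?V. e \<subseteq> t} | t. t \<in> M \<and> card t = n \<and> crossing f x t}" (is "?l = ?r")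
    if X: "\<And>P Q. P \<subseteq> ?A \<Longrightarrow> Q \<subseteq> ?B \<Longrightarrow> P \<noteq> {} \<Longrightarrow> Q \<noteq> {} \<Longrightarrow> finite P \<Longrightarrow> finite Q \<Longrightarrow>
       card P + card Q = n \<Longrightarrow> P \<union> Q \<in> M \<longleftrightarrow> (card P, card Q) \<in> X"
     and X0: "\<And>p q. (p, q) \<in> X \<Longrightarrow> 0 < p \<and> 0 < q \<and> p + q = n" for X n
  proof
    show "?l \<subseteq> ?r"
    proof
      fix Y assume "Y \<in> ?l"
      then obtain P Q where PQ: "P \<subseteq> ?A" "Q \<subseteq> ?B" "(card P, card Q) \<in> X" "Y = ?\<phi> ` (P \<times> Q)"
        by auto
      have c: "0 < card P" "0 < card Q" "card P + card Q = n"
        using X0 PQ(3) by auto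
      then have fin: "finite P" "finite Q" "P \<noteq> {}" "Q \<noteq> {}"
        by (auto simp: card_gt_0_iff)
      have "P \<inter> Q = {}"
        using PQ A B by fastforce
      then have "card (P \<union> Q) = n"
        using fin c by (simp add: card_Un_disjoint)
      moreover have "P \<union> Q \<in> M"
        using X[OF PQ(1,2)] PQ(3) fin c by blast
      moreover have "crossing f x (P \<union> Q)"
        using fin PQ A B unfolding crossing_def by blast
      ultimately show "Y \<in> ?r"
        using ph[OF PQ(1,2)] PQ(4) by blast
    qed
    show "?r \<subseteq> ?l"
    proof
      fix Y assume "Y \<in> ?r"
      then obtain t where t: "t \<in> M" "card t = n" "crossing f x t" "Y = {e \<in> ?V. e \<subseteq> t}"
        by auto
      have tAB: "t \<subseteq> ?A \<union> ?B"
        using crossing_parts[OF sc x t(1,3)] .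
      define P where "P = t \<inter> ?A"
      define Q where "Q = t \<inter> ?B"
      have fin: "finite t"
        using sc t(1) by (simp add: simplicial_complex_def)
      have tPQ: "t = P \<union> Q"
        using tAB by (auto simp: P_def Q_def)
      have "P \<inter> Q = {}"
        using A B by (fastforce simp: P_def Q_def)
      then have c: "card P + card Q = n"
        using t(2) fin unfolding tPQ by (simp add: card_Un_disjoint)
      have ne: "P \<noteq> {}" "Q \<noteq> {}"
      proof -
        obtain u w where "u \<in> t" "f u < x" "w \<in> t" "x < f w"
          using t by (auto simp: crossing_def)
        then show "P \<noteq> {}" "Q \<noteq> {}"
          using tAB A[of w] B[of u] by (auto simp: P_def Q_def)
      qed
      have sub: "P \<subseteq> ?A" "Q \<subseteq> ?B"
        by (auto simp: P_def Q_def)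
      have "(card P, card Q) \<in> X"
        using X[OF sub ne _ _ c] t(1) fin unfolding tPQ by simp
      moreover have "Y = ?\<phi> ` (P \<times> Q)"
        using ph[OF sub] t(4) tPQ by simp
      ultimately show "Y \<in> ?l"
        using sub by blast
    qed
  qed
  have inj: "inj_on ?\<phi> (?A \<times> ?B)"
    using A B by (fastforce simp: inj_on_def doubleton_eq_iff)
  have "?\<phi> ` (?A \<times> ?B) = ?V"
    unfolding V by auto
  then have bij: "bij_betw ?\<phi> (?A \<times> ?B) ?V"
    using inj by (simp add: bij_betw_def)
  have E: "(\<lambda>e. ?\<phi> ` e) ` {P \<times> Q | P Q. P \<subseteq> ?A \<and> Q \<subseteq> ?B \<and> (card P, card Q) \<in> {(1,2),(2,1)}} =
     {{e \<in> ?V. e \<subseteq> t} | t. t \<in> M \<and> card t = 3 \<and> crossing f x t}"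
  proof (rule faces)
    fix P Q assume PQ: "P \<subseteq> ?A" "Q \<subseteq> ?B" "P \<noteq> {}" "Q \<noteq> {}" "finite P" "finite Q" "card P + card Q = 3"
    then have "0 < card P" "0 < card Q"
      by (auto simp: card_gt_0_iff)
    then have c: "card P = 1 \<and> card Q = 2 \<or> card P = 2 \<and> card Q = 1"
      using PQ(7) by linarith
    then obtain a a' b b' where "P = {a,a'}" "Q = {b,b'}"
      by (metis card_1_or_2E)
    then have "P \<union> Q \<in> M"
      using weakly_neighborly_complete[OF sc wn, of a a' b b'] PQ by (simp add: insert_commute)
    then show "P \<union> Q \<in> M \<longleftrightarrow> (card P, card Q) \<in> {(1,2),(2,1)}"
      using c by auto
  qed auto
  have F: "(\<lambda>e. ?\<phi> ` e) ` {P \<times> Q | P Q. P \<subseteq> ?A \<and> Q \<subseteq> ?B \<and> (card P, card Q) \<in> R} =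
     {{e \<in> ?V. e \<subseteq> t} | t. t \<in> M \<and> card t = 4 \<and> crossing f x t}"
  proof (rule faces)
    fix P Q assume PQ: "P \<subseteq> ?A" "Q \<subseteq> ?B" "P \<noteq> {}" "Q \<noteq> {}" "finite P" "finite Q" "card P + card Q = 4"
    then have "0 < card P" "0 < card Q"
      by (auto simp: card_gt_0_iff)
    then have "(card P, card Q) \<in> {(1,3),(2,2),(3,1)}"
      using PQ(7) by auto
    then show "P \<union> Q \<in> M \<longleftrightarrow> (card P, card Q) \<in> R"
      using R PQ by blast
  qed (use R0 in auto)
  \<comment> \<open>The map goes from the grid to the slice; since all cells of the product lie in
    the grid, it can be inverted afterwards.\<close>
  have "comb_iso (product_map ?A ?B R) (slicing M f x)"
    unfolding comb_iso_def product_map_def slicing_def prod.case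
    using bij E F by (intro exI[of _ ?\<phi>] conjI)
  then show ?thesis
    unfolding product_map_def by (rule comb_iso_sym) blast+
qed

text \<open>Up to isomorphism a product depends only on the two cardinalities and \<open>R\<close>,
  so the index sets may be replaced by sets of numbers.\<close>

lemma slicing_comb_iso_model:
  fixes I J :: "nat set"
  assumes "simplicial_complex M" "x \<notin> f ` cvertices M" "weakly_neighborly (slicing M f x)"
    and "R \<subseteq> {(1,3),(2,2),(3,1)}"
    and "\<And>P Q. P \<subseteq> lower M f x \<Longrightarrow> Q \<subseteq> upper M f x \<Longrightarrow>
      (card P, card Q) \<in> {(1,3),(2,2),(3,1)} \<Longrightarrow> P \<union> Q \<in> M \<longleftrightarrow> (card P, card Q) \<in> R"
    and fin: "finite (lower M f x)" "finite (upper M f x)" "finite I" "finite J"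
    and "card (lower M f x) = card I" "card (upper M f x) = card J"
    and "comb_iso (product_map I J R) T"
  shows "comb_iso (slicing M f x) T"
proof -
  obtain g k where "bij_betw g (lower M f x) I" "bij_betw k (upper M f x) J"
    using assms by (metis finite_same_card_bij)
  then show ?thesis
    using slicing_comb_iso_product_map[OF assms(1-5)] product_map_cong assms(12) comb_iso_trans
    by metis
qed

section \<open>Slices with a single lower vertex\<close>

text \<open>The two triangles at an edge already give four vertices, so every triple has a vertex
  outside it and spans a triangle by the three-cycle lemma. Hence every vertex off the edge
  completes it to a triangle, and there are exactly two of these.\<close>

lemma neighborly_sphere_four_vertices:
  assumes S: "combinatorial_2_sphere L"
    and nb: "\<And>u w. u \<in> \<Union>L \<Longrightarrow> w \<in> \<Union>L \<Longrightarrow> {u,w} \<in> L"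
  shows "card (\<Union>L) = 4" and "\<And>T. T \<subseteq> \<Union>L \<Longrightarrow> card T = 3 \<Longrightarrow> T \<in> L"
proof -
  have L: "simplicial_complex L" "pure_dim L 2"
    using S by (auto simp: combinatorial_2_sphere_def)
  have fin: "finite (\<Union>L)"
    using L(1) by (auto simp: simplicial_complex_def)
  obtain t where "t \<in> L" "card t = 3"
    using L(2) by (fastforce simp: pure_dim_def)
  then obtain b b' b'' where "{b,b',b''} \<in> L" and bb: "b \<noteq> b'"
    by (auto simp: card_3_iff)
  then have bb: "b \<in> \<Union>L" "b' \<in> \<Union>L" "b \<noteq> b'"
    by blast+
  define N where "N = {v. v \<notin> {b,b'} \<and> {b,b',v} \<in> L}"
  have N: "card N = 2"
    unfolding N_def using sphere_edge_in_two_triangles[OF S nb[OF bb(1,2)] bb(3)] .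
  have NL: "N \<subseteq> \<Union>L - {b,b'}"
    by (auto simp: N_def)
  have cd: "card (\<Union>L - {b,b'}) = card (\<Union>L) - 2"
    using bb fin by (subst card_Diff_subset) auto
  have "2 \<le> card (\<Union>L - {b,b'})"
    using card_mono[OF _ NL] N fin by simp
  then have ge: "4 \<le> card (\<Union>L)"
    using cd by linarith
  have tri: "T \<in> L" if T: "T \<subseteq> \<Union>L" "card T = 3" for T
  proof -
    obtain w where w: "w \<in> \<Union>L" "w \<notin> T"
    proof -
      have "T \<noteq> \<Union>L"
        using T(2) ge by auto
      then show thesis
        using that T(1) by blast
    qed
    obtain x y z where "T = {x,y,z}" "distinct [x,y,z]"
      using T(2) by (auto simp: card_3_iff)
    then show ?thesis
      using neighborly_sphere_three_cycle_bounds[OF S nb, of x y z w] T(1) w by auto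
  qed
  have "\<Union>L - {b,b'} \<subseteq> N"
  proof
    fix v assume v: "v \<in> \<Union>L - {b,b'}"
    then have "{b,b',v} \<in> L"
      using bb by (intro tri) auto
    then show "v \<in> N"
      using v by (simp add: N_def)
  qed
  then have "\<Union>L - {b,b'} = N"
    using NL by blast
  then show "card (\<Union>L) = 4"
    using cd N ge by simp
  show "\<And>T. T \<subseteq> \<Union>L \<Longrightarrow> card T = 3 \<Longrightarrow> T \<in> L"
    by (rule tri)
qed

text \<open>A tetrahedron that crosses the level consists of \<open>a\<close> and a triangle of its
  link, so the slice is a copy of the link, provided that the link lies entirely above the
  level.\<close>

lemma slicing_vertex_link:
  fixes M :: "'v set set"
  assumes M: "combinatorial_3_manifold M" and x: "x \<notin> f ` cvertices M"
    and wn: "weakly_neighborly (slicing M f x)"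
    and A: "lower M f x = {a}" and ne: "upper M f x \<noteq> {}"
  shows "comb_iso (slicing M f x) tetra_boundary"
proof -
  let ?B = "upper M f x" and ?L = "link M a"
  have sc: "simplicial_complex M"
    using M by (simp add: combinatorial_3_manifold_def)
  have aM: "{a,b,b'} \<in> M" if "b \<in> ?B" "b' \<in> ?B" for b b'
    using weakly_neighborly_complete[OF sc wn _ _ that, of a a] A by simp
  have aB: "a \<notin> ?B" and fa: "f a < x"
    using A by (auto simp: lower_def upper_def set_eq_iff)
  have link_iff: "\<sigma> \<in> ?L \<longleftrightarrow> a \<notin> \<sigma> \<and> insert a \<sigma> \<in> M" if "\<sigma> \<noteq> {}" for \<sigma>
    using that simplicial_complex_subset[OF sc, of "insert a \<sigma>" \<sigma>] by (auto simp: link_def)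
  have nbB: "{b,b'} \<in> ?L" if "b \<in> ?B" "b' \<in> ?B" for b b'
    using aM that aB by (auto simp: link_iff)
  obtain b where b: "b \<in> ?B"
    using ne by blast
  have "a \<in> cvertices M"
    using aM[OF b b] by (auto simp: cvertices_def)
  then have S: "combinatorial_2_sphere ?L"
    using M by (simp add: combinatorial_3_manifold_def)
  \<comment> \<open>If a link vertex \<open>u\<close> is upper, then for a neighbour
    \<open>w\<close> the triangle \<open>{a,u,w}\<close> crosses the level, so \<open>w\<close> is
    upper or equal to \<open>a\<close>; connectedness of the link spreads this to all its
    vertices.\<close>
  have "\<Union>?L \<subseteq> ?B"
  proof (rule sphere_vertices_connected[OF S _ b])
    show "b \<in> \<Union>?L"
      using nbB[OF b b] by auto
    fix u w assume uw: "{u,w} \<in> ?L" "u \<in> ?B"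
    then have t: "{a,u,w} \<in> M" "a \<noteq> w"
      by (auto simp: link_iff)
    moreover have "crossing f x {a,u,w}"
      using fa uw(2) by (auto simp: crossing_def upper_def)
    ultimately show "w \<in> ?B"
      using crossing_parts[OF sc x] A by fastforce
  qed
  then have LB: "\<Union>?L = ?B"
    using nbB by blast
  have four: "card ?B = 4" and tri: "T \<subseteq> ?B \<Longrightarrow> card T = 3 \<Longrightarrow> T \<in> ?L" for T
    using neighborly_sphere_four_vertices[OF S] nbB unfolding LB by blast+
  show ?thesis
  proof (rule slicing_comb_iso_model[OF sc x wn, of "{(1,3)}"])
    fix P Q assume PQ: "P \<subseteq> lower M f x" "Q \<subseteq> ?B" "(card P, card Q) \<in> {(1,3),(2,2),(3,1)}"
    then have "P \<noteq> {}"
      by auto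
    then have P: "P = {a}"
      using A PQ(1) by (auto dest: subset_singletonD)
    then have "Q \<in> ?L"
      using tri PQ by auto
    then show "P \<union> Q \<in> M \<longleftrightarrow> (card P, card Q) \<in> {(1,3)}"
      using P PQ by (auto simp: link_def)
  qed (use four A product_map_tetra in \<open>auto intro: card_ge_0_finite\<close>)
qed

section \<open>Counting tetrahedra at a crossing triangle\<close>

text \<open>\<open>N\<close> is the set of apexes over the triangle \<open>a a' b\<close>.
  Completeness puts every other upper vertex into it, while its size is two; this is the source of
  all bounds below.\<close>

lemma slicing_tetrahedra_at_lower_edge:
  fixes M :: "'v set set"
  assumes M: "combinatorial_3_manifold M" and x: "x \<notin> f ` cvertices M"
    and wn: "weakly_neighborly (slicing M f x)"
    and a: "a \<in> lower M f x" "a' \<in> lower M f x" "a \<noteq> a'" and b: "b \<in> upper M f x"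
  defines "N \<equiv> {v. v \<notin> {a,a',b} \<and> {a,a',b,v} \<in> M}"
  shows "card N = 2" "upper M f x - {b} \<subseteq> N"
    "N \<subseteq> (lower M f x - {a,a'}) \<union> (upper M f x - {b})"
proof -
  have sc: "simplicial_complex M"
    using M by (simp add: combinatorial_3_manifold_def)
  have fab: "f a < x" "f a' < x" "x < f b"
    using a b by (auto simp: lower_def upper_def)
  have "{a,a',b} \<in> M"
    using weakly_neighborly_complete[OF sc wn a(1,2) b b] by simp
  then show "card N = 2"
    unfolding N_def using a(3) fab by (intro triangle_in_two_tetrahedra[OF M]) auto
  show "upper M f x - {b} \<subseteq> N"
  proof
    fix v assume v: "v \<in> upper M f x - {b}"
    then have "x < f v" by (auto simp: upper_def)
    then show "v \<in> N"
      using weakly_neighborly_complete[OF sc wn a(1,2) b, of v] v fab by (auto simp: N_def)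
  qed
  show "N \<subseteq> (lower M f x - {a,a'}) \<union> (upper M f x - {b})"
  proof
    fix v assume v: "v \<in> N"
    then have "{a,a',b,v} \<in> M" by (simp add: N_def)
    moreover have "crossing f x {a,a',b,v}"
      using fab by (auto simp: crossing_def)
    ultimately show "v \<in> (lower M f x - {a,a'}) \<union> (upper M f x - {b})"
      using crossing_parts[OF sc x, of "{a,a',b,v}"] v by (auto simp: N_def)
  qed
qed

lemma slicing_tetrahedra_at_upper_edge:
  fixes M :: "'v set set"
  assumes M: "combinatorial_3_manifold M" and x: "x \<notin> f ` cvertices M"
    and wn: "weakly_neighborly (slicing M f x)"
    and b: "b \<in> upper M f x" "b' \<in> upper M f x" "b \<noteq> b'" and a: "a \<in> lower M f x"
  defines "N \<equiv> {v. v \<notin> {b,b',a} \<and> {b,b',a,v} \<in> M}"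
  shows "card N = 2" "lower M f x - {a} \<subseteq> N"
    "N \<subseteq> (upper M f x - {b,b'}) \<union> (lower M f x - {a})"
proof -
  have x': "- x \<notin> (\<lambda>v. - f v) ` cvertices M"
    using x by auto
  have wn': "weakly_neighborly (slicing M (\<lambda>v. - f v) (- x))"
    using wn by (simp add: slicing_uminus)
  note q = slicing_tetrahedra_at_lower_edge[OF M x' wn', unfolded lower_uminus upper_uminus, OF b a]
  show "card N = 2" "lower M f x - {a} \<subseteq> N"
    "N \<subseteq> (upper M f x - {b,b'}) \<union> (lower M f x - {a})"
    unfolding N_def using q by blast+
qed

text \<open>The two tetrahedra at a triangle \<open>a a' b\<close> are used up by the other two
  upper vertices, so no lower vertex can be an apex over it.\<close>

lemma slicing_no_lower_triangle:
  fixes M :: "'v set set"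
  assumes M: "combinatorial_3_manifold M" and x: "x \<notin> f ` cvertices M"
    and wn: "weakly_neighborly (slicing M f x)"
    and B: "card (upper M f x) = 3" and b: "b \<in> upper M f x"
    and P: "P \<subseteq> lower M f x" "card P = 3"
  shows "insert b P \<notin> M"
proof
  assume t: "insert b P \<in> M"
  obtain a a' a'' where a: "P = {a,a',a''}" "a \<noteq> a'" "a \<noteq> a''" "a' \<noteq> a''"
    using P(2) by (auto simp: card_3_iff)
  define N where "N = {v. v \<notin> {a,a',b} \<and> {a,a',b,v} \<in> M}"
  have N: "card N = 2" "upper M f x - {b} \<subseteq> N"
    unfolding N_def using P a by (intro slicing_tetrahedra_at_lower_edge[OF M x wn _ _ _ b]; auto)+
  have "finite N"
    using N(1) by (simp add: card_ge_0_finite)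
  moreover have "card (upper M f x - {b}) = 2"
    using B b by (simp add: card_ge_0_finite)
  ultimately have "upper M f x - {b} = N"
    using N by (intro card_subset_eq) auto
  moreover have "a'' \<in> N"
  proof -
    have "a'' \<noteq> b"
      using P(1) a(1) b by (auto simp: lower_def upper_def)
    moreover have "{a,a',b,a''} = insert b P"
      using a(1) by blast
    ultimately show ?thesis
      using t a by (simp add: N_def)
  qed
  ultimately have "a'' \<in> upper M f x" "a'' \<in> lower M f x"
    using P(1) a(1) by auto
  then show False
    by (simp add: lower_def upper_def)
qed

section \<open>The torus and the prism\<close>

lemma slicing_torus:
  fixes M :: "'v set set"
  assumes M: "combinatorial_3_manifold M" and x: "x \<notin> f ` cvertices M"
    and wn: "weakly_neighborly (slicing M f x)"
    and A: "card (lower M f x) = 3" and B: "card (upper M f x) = 3"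
  shows "comb_iso (slicing M f x) torus_3x3"
proof -
  have sc: "simplicial_complex M"
    using M by (simp add: combinatorial_3_manifold_def)
  have x': "- x \<notin> (\<lambda>v. - f v) ` cvertices M"
    using x by auto
  have wn': "weakly_neighborly (slicing M (\<lambda>v. - f v) (- x))"
    using wn by (simp add: slicing_uminus)
  \<comment> \<open>The reflected statement: no tetrahedron has one lower and three upper vertices.
    With the direct one, only the shape (2,2) is left.\<close>
  note no_upper = slicing_no_lower_triangle[OF M x' wn', unfolded lower_uminus upper_uminus, OF A]
  have refl: "comb_iso torus_3x3 torus_3x3"
    unfolding comb_iso_def torus_3x3_def prod.case by (intro exI[of _ id] conjI) simp_all
  show ?thesis
  proof (rule slicing_comb_iso_model[OF sc x wn, of "{(2,2)}" "{0..<3}" "{0..<3}"])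
    fix P Q assume PQ: "P \<subseteq> lower M f x" "Q \<subseteq> upper M f x" "(card P, card Q) \<in> {(1,3),(2,2),(3,1)}"
    then consider "card P = 1" "card Q = 3" | "card P = 2" "card Q = 2" | "card P = 3" "card Q = 1"
      by auto
    then show "P \<union> Q \<in> M \<longleftrightarrow> (card P, card Q) \<in> {(2,2)}"
    proof cases
      case 1
      then obtain a where "P = {a}"
        by (auto simp: card_1_singleton_iff)
      then show ?thesis
        using no_upper[of a Q] PQ 1 by simp
    next
      case 2
      then obtain a a' b b' where "P = {a,a'}" "Q = {b,b'}"
        by (metis card_2_iff)
      then show ?thesis
        using weakly_neighborly_complete[OF sc wn, of a a' b b'] PQ 2 by (simp add: insert_commute)
    next
      case 3
      then obtain b where "Q = {b}"
        by (auto simp: card_1_singleton_iff)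
      then show ?thesis
        using slicing_no_lower_triangle[OF M x wn B, of b P] PQ 3 by simp
    qed
  qed (use A B refl product_map_torus in \<open>auto intro: card_ge_0_finite\<close>)
qed

text \<open>The shape (3,1) is ruled out by size. The shape (1,3) must occur: a triangle
  \<open>b b' a\<close> has two apexes but only one other lower vertex is available, so the third
  upper vertex is an apex too.\<close>

lemma slicing_prism:
  fixes M :: "'v set set"
  assumes M: "combinatorial_3_manifold M" and x: "x \<notin> f ` cvertices M"
    and wn: "weakly_neighborly (slicing M f x)"
    and A: "card (lower M f x) = 2" and B: "card (upper M f x) = 3"
  shows "comb_iso (slicing M f x) prism_boundary"
proof -
  have sc: "simplicial_complex M"
    using M by (simp add: combinatorial_3_manifold_def)
  have finA: "finite (lower M f x)" and finB: "finite (upper M f x)"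
    using A B by (simp_all add: card_ge_0_finite)
  have tri: "insert a (upper M f x) \<in> M" if a: "a \<in> lower M f x" for a
  proof -
    obtain b b' b'' where b: "upper M f x = {b,b',b''}" "b \<noteq> b'" "b \<noteq> b''" "b' \<noteq> b''"
      using B by (auto simp: card_3_iff)
    define N where "N = {v. v \<notin> {b,b',a} \<and> {b,b',a,v} \<in> M}"
    have N: "card N = 2" "N \<subseteq> (upper M f x - {b,b'}) \<union> (lower M f x - {a})"
      unfolding N_def using b by (intro slicing_tetrahedra_at_upper_edge[OF M x wn _ _ _ a]; auto)+
    have "upper M f x - {b,b'} = {b''}"
      using b by auto
    then have N': "N \<subseteq> insert b'' (lower M f x - {a})"
      using N(2) by simp
    have "card (lower M f x - {a}) = 1"
      using A a finA by simp
    then have "\<not> N \<subseteq> lower M f x - {a}"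
      using N(1) card_mono[of "lower M f x - {a}" N] finA by auto
    then have "b'' \<in> N"
      using N' by blast
    then show ?thesis
      using b by (simp add: N_def insert_commute)
  qed
  show ?thesis
  proof (rule slicing_comb_iso_model[OF sc x wn, of "{(2,2),(1,3)}" "{0..<2}" "{0..<3}"])
    fix P Q assume PQ: "P \<subseteq> lower M f x" "Q \<subseteq> upper M f x" "(card P, card Q) \<in> {(1,3),(2,2),(3,1)}"
    have "card P \<le> 2"
      using card_mono[OF finA PQ(1)] A by simp
    then consider "card P = 1" "card Q = 3" | "card P = 2" "card Q = 2"
      using PQ(3) by auto
    then show "P \<union> Q \<in> M \<longleftrightarrow> (card P, card Q) \<in> {(2,2),(1,3)}"
    proof cases
      case 1
      then obtain a where "P = {a}"
        by (auto simp: card_1_singleton_iff)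
      moreover have "Q = upper M f x"
        using card_subset_eq[OF finB PQ(2)] 1 B by simp
      ultimately show ?thesis
        using tri[of a] PQ 1 by simp
    next
      case 2
      then obtain a a' b b' where "P = {a,a'}" "Q = {b,b'}"
        by (metis card_2_iff)
      then show ?thesis
        using weakly_neighborly_complete[OF sc wn, of a a' b b'] PQ 2 by (simp add: insert_commute)
    qed
  qed (use A B finA finB product_map_prism in auto)
qed

section \<open>Case distinction on the numbers of lower and upper vertices\<close>

theorem theorem5p5:
  fixes M :: "'v set set" and f :: "'v \<Rightarrow> real" and x :: real
  assumes "combinatorial_3_manifold M"
    and "inj_on f (cvertices M)"
    and "x \<notin> f ` cvertices M"
    and "polyhedral_map (slicing M f x)"
    and "weakly_neighborly (slicing M f x)"
  shows "comb_iso (slicing M f x) tetra_boundary \<or>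
         comb_iso (slicing M f x) prism_boundary \<or>
         comb_iso (slicing M f x) torus_3x3"
proof -
  let ?A = "lower M f x" and ?B = "upper M f x" and ?g = "\<lambda>v. - f v"
  note M = assms(1) and x = assms(3) and wn = assms(5)
  have x': "- x \<notin> ?g ` cvertices M"
    using x by auto
  have wn': "weakly_neighborly (slicing M ?g (- x))"
    using wn by (simp add: slicing_uminus)
  \<comment> \<open>A polyhedral map has a vertex; the corresponding crossing edge provides
    \<open>a\<close> and \<open>b\<close>.\<close>
  have "slice_vertices M f x \<noteq> {}"
    using assms(4) by (simp add: polyhedral_map_def slicing_def)
  then obtain a b where a: "a \<in> ?A" and b: "b \<in> ?B"
    unfolding slice_vertices_eq lower_def upper_def by blast
  have "?A \<union> ?B \<subseteq> \<Union>M"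
    by (auto simp: lower_def upper_def)
  moreover have "finite (\<Union>M)"
    using M by (auto simp: combinatorial_3_manifold_def simplicial_complex_def)
  ultimately have fin: "finite ?A" "finite ?B"
    using finite_subset by auto
  have pos: "0 < card ?A" "0 < card ?B"
    using a b fin by (auto simp: card_gt_0_iff)
  consider "card ?A = 1" | "card ?B = 1" | "2 \<le> card ?A" "2 \<le> card ?B"
    using pos by linarith
  then show ?thesis
  proof cases
    case 1
    then have "?A = {a}"
      using a by (metis card_1_singletonE singletonD)
    then show ?thesis
      using slicing_vertex_link[OF M x wn] b by blast
  next
    case 2
    then have "?B = {b}"
      using b by (metis card_1_singletonE singletonD)
    then have "comb_iso (slicing M ?g (- x)) tetra_boundary"
      using slicing_vertex_link[OF M x' wn'] a unfolding lower_uminus upper_uminus by blast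
    then show ?thesis
      by (simp add: slicing_uminus)
  next
    case 3
    have "\<not> ?A \<subseteq> {a}" "\<not> ?B \<subseteq> {b}"
      using 3 card_mono[of "{a}" ?A] card_mono[of "{b}" ?B] by auto
    then obtain a' b' where a': "a' \<in> ?A" "a \<noteq> a'" and b': "b' \<in> ?B" "b \<noteq> b'"
      by blast
    define N where "N = {v. v \<notin> {a,a',b} \<and> {a,a',b,v} \<in> M}"
    have N: "card N = 2" "?B - {b} \<subseteq> N" "N \<subseteq> (?A - {a,a'}) \<union> (?B - {b})"
      unfolding N_def by (intro slicing_tetrahedra_at_lower_edge[OF M x wn a a' b])+
    define N' where "N' = {v. v \<notin> {b,b',a} \<and> {b,b',a,v} \<in> M}"
    have N': "card N' = 2" "?A - {a} \<subseteq> N'"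
      unfolding N'_def by (intro slicing_tetrahedra_at_upper_edge[OF M x wn b b' a])+
    \<comment> \<open>All upper vertices other than \<open>b\<close> are apexes over
      \<open>a a' b\<close>, of which there are two; the bound for \<open>?A\<close> is the mirror
      image.\<close>
    have "card (?B - {b}) \<le> 2"
      using card_mono[OF _ N(2)] N(1) by (simp add: card_ge_0_finite)
    moreover have "card (?A - {a}) \<le> 2"
      using card_mono[OF _ N'(2)] N'(1) by (simp add: card_ge_0_finite)
    ultimately have "card ?A \<le> 3" "card ?B \<le> 3"
      using a b fin by auto
    \<comment> \<open>With two vertices on each side, the only candidate apex over
      \<open>a a' b\<close> is the other upper vertex, but two apexes are needed.\<close>
    moreover have "\<not> (card ?A = 2 \<and> card ?B = 2)"
    proof
      assume c: "card ?A = 2 \<and> card ?B = 2"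
      then have "card (?A - {a,a'}) = 0"
        using a a' fin by (subst card_Diff_subset) auto
      then have "?A - {a,a'} = {}"
        using fin by simp
      then have "N \<subseteq> ?B - {b}"
        using N(3) by blast
      then have "card N \<le> card (?B - {b})"
        using fin by (intro card_mono) auto
      then show False
        using N(1) c b fin by simp
    qed
    ultimately consider "card ?A = 3" "card ?B = 3" | "card ?A = 2" "card ?B = 3"
      | "card ?A = 3" "card ?B = 2"
      using 3 by linarith
    then show ?thesis
    proof cases
      case 1
      then show ?thesis
        using slicing_torus[OF M x wn] by blast
    next
      case 2
      then show ?thesis
        using slicing_prism[OF M x wn] by blast
    next
      case 3
      then have "comb_iso (slicing M ?g (- x)) prism_boundary"
        using slicing_prism[OF M x' wn'] unfolding lower_uminus upper_uminus by blast
      then show ?thesis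
        by (simp add: slicing_uminus)
    qed
  qed
qed

end
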